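(* Let $\wp$ be a Weierstrass elliptic function with respect to a lattice in $\mathbb{C}$, and let $c\in\mathbb{C}$ be a number that is not a pole of $\wp$. Let $f(z)=\wp(e^z+c)$. Then $\dim\mathcal{I}(f)=2$, where $\mathcal{I}(f)$ is the escaping set of $f$ and $\dim$ denotes Hausdorff dimension.
   Context: For $w_1,w_2\in\mathbb{C}$ such that $w_1$ is not a real multiple of $w_2$, put $\Lambda=\{mw_1+nw_2: m,n\in\mathbb{Z}\}$. The Weierstrass elliptic function with respect to the lattice $\Lambda$ is $\wp(z)=\frac{1}{z^2}+\sum_{w\in\Lambda\setminus\{0\}}\left(\frac{1}{(z-w)^2}-\frac{1}{w^2}\right)$. The escaping set of a transcendental meromorphic function $f:\mathbb{C}\to\widehat{\mathbb{C}}$ is $\mathcal{I}(f)=\{z\in\mathbb{C}: f^n(z)\to\infty \text{ as } n\to\infty\}$, where $f^n$ is the $n$-th iterate of $f$ (all iterates $f^n(z)$ are required to be defined). *)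

theory Defs
  imports "HOL-Complex_Analysis.Complex_Analysis"
begin

definition period_lattice :: "complex \<Rightarrow> complex \<Rightarrow> complex set" where
  "period_lattice w1 w2 = {of_int m * w1 + of_int n * w2 | m n :: int. True}"

(* The values at lattice points are junk (division by zero); there the function has poles. *)
definition weierstrass_p :: "complex \<Rightarrow> complex \<Rightarrow> complex \<Rightarrow> complex" where
  "weierstrass_p w1 w2 z =
     1 / z ^ 2 + (\<Sum>\<^sub>\<infinity>w \<in> period_lattice w1 w2 - {0}. 1 / (z - w) ^ 2 - 1 / w ^ 2)"

(* A meromorphic function is represented by a total function whose values at its poles are
   irrelevant. All iterates of z are defined iff the orbit of z never meets a pole. *)
definition escaping_set :: "(complex \<Rightarrow> complex) \<Rightarrow> complex set" where
  "escaping_set f =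
     {z. (\<forall>n. \<not> is_pole f ((f ^^ n) z)) \<and> filterlim (\<lambda>n. (f ^^ n) z) at_infinity sequentially}"

(* The contribution diam(U)^s of a set U to a cover, with 0^0 = 1 for a nonempty U (whereas
   0 powr 0 = 0) and contribution 0 for the empty set. *)
definition diam_pow :: "real \<Rightarrow> 'a::metric_space set \<Rightarrow> ennreal" where
  "diam_pow s U = (if U = {} then 0 else if s = 0 then 1 else ennreal (diameter U powr s))"

(* Boundedness is required because the library's diameter is meaningless on unbounded sets. *)
definition hausdorff_content :: "real \<Rightarrow> real \<Rightarrow> 'a::metric_space set \<Rightarrow> ennreal" where
  "hausdorff_content s \<delta> A =
     (INF U \<in> {U :: nat \<Rightarrow> 'a set. A \<subseteq> (\<Union>i. U i) \<and> (\<forall>i. bounded (U i) \<and> diameter (U i) \<le> \<delta>)}.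
        (\<Sum>i. diam_pow s (U i)))"

definition hausdorff_measure :: "real \<Rightarrow> 'a::metric_space set \<Rightarrow> ennreal" where
  "hausdorff_measure s A = (SUP \<delta> \<in> {0<..}. hausdorff_content s \<delta> A)"

definition hausdorff_dim :: "'a::metric_space set \<Rightarrow> ennreal" where
  "hausdorff_dim A = Inf {ennreal s | s. 0 \<le> s \<and> hausdorff_measure s A = 0}"

end

theory Submission
  imports Defs "HOL-Real_Asymp.Real_Asymp"
begin

text \<open>
  Write \<open>f z = \<wp> (exp z + c)\<close>. In a strip \<open>x \<le> Re z \<le> x + 1\<close>, \<open>\<bar>Im z\<bar> \<le> \<pi>\<close> with \<open>x\<close> large, there are at
  least a constant times \<open>exp (2 x)\<close> poles of \<open>f\<close>, and near each of them \<open>f\<close> has the form \<open>1/u\<^sup>2 + h u\<close>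
  with \<open>u = exp z + c - w\<close> and a Lipschitz function \<open>h\<close> that does not depend on the lattice point \<open>w\<close>.
  So each pole has next to it a piece that \<open>f\<close> maps over the whole strip at \<open>x + 1\<close>, and
  \<open>f\<close> stretches distances there by at most a polynomial in \<open>x\<close> times \<open>exp x\<close>. Points whose orbit runs through
  the strips at \<open>X\<close>, \<open>X + 1\<close>, \<open>X + 2\<close>, \<open>\<dots>\<close> escape. Since the number of branches beats the \<open>s\<close>-th
  power of the expansion for every \<open>s < 2\<close> once \<open>X\<close> is large, and the distance of neighbouring pieces
  (about \<open>exp (- x)\<close>) is negligible compared with the accumulated gain \<open>X + (X + 1) + \<dots>\<close> in the
  exponent, these points have positive \<open>s\<close>-dimensional measure. No distortion estimate is needed.
\<close>

section \<open>Hausdorff measure and dimension\<close>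

lemma diam_pow_pos:
  assumes "0 < s"
  shows "diam_pow s U = ennreal (diameter U powr s)"
  using assms by (auto simp: diam_pow_def diameter_empty)

lemma diam_pow_antimono:
  assumes "0 \<le> s" "s \<le> t" "bounded U" "diameter U \<le> 1"
  shows "diam_pow t U \<le> diam_pow s U"
proof -
  have "0 \<le> diameter U"
    using assms(3) by (rule diameter_ge_0)
  have "diameter U powr t \<le> diameter U powr s"
    if "0 < s"
    using powr_mono'[OF \<open>s \<le> t\<close> \<open>0 \<le> diameter U\<close> \<open>diameter U \<le> 1\<close>] .
  \<comment> \<open>For s = 0 a nonempty set contributes 1 whatever its diameter; this bound covers
    that case.\<close>
  moreover have "diameter U powr t \<le> 1"
    using \<open>0 \<le> diameter U\<close> assms by (intro powr_le1) auto
  ultimately show ?thesis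
    using assms by (auto simp: diam_pow_def intro!: ennreal_leI simp flip: ennreal_1)
qed

lemma hausdorff_content_mono_set:
  "A \<subseteq> B \<Longrightarrow> hausdorff_content s \<delta> A \<le> hausdorff_content s \<delta> B"
  unfolding hausdorff_content_def by (rule INF_superset_mono) auto

lemma hausdorff_measure_mono_set:
  "A \<subseteq> B \<Longrightarrow> hausdorff_measure s A \<le> hausdorff_measure s B"
  unfolding hausdorff_measure_def by (intro SUP_mono) (auto intro: hausdorff_content_mono_set)

lemma hausdorff_measure_eq_0_iff:
  "hausdorff_measure s A = 0 \<longleftrightarrow> (\<forall>\<delta>>0. hausdorff_content s \<delta> A = 0)"
proof -
  have "(hausdorff_measure s A = bot) = (\<forall>\<delta>\<in>{0<..}. hausdorff_content s \<delta> A = bot)"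
    unfolding hausdorff_measure_def by (rule SUP_bot_conv)
  then show ?thesis by (auto simp: bot_ennreal)
qed

lemma hausdorff_measure_eq_0_mono:
  assumes "hausdorff_measure s A = 0" "0 \<le> s" "s \<le> t"
  shows "hausdorff_measure t A = 0"
  unfolding hausdorff_measure_eq_0_iff
proof (intro allI impI)
  fix \<delta> :: real assume "\<delta> > 0"
  \<comment> \<open>Restricting to covers of mesh at most 1 costs nothing, since the content for
    \<open>s\<close> vanishes at every mesh, and on such covers raising the exponent lowers each
    term.\<close>
  have "hausdorff_content t \<delta> A \<le> hausdorff_content s (min \<delta> 1) A"
    unfolding hausdorff_content_def
  proof (rule INF_mono)
    fix U :: "nat \<Rightarrow> 'a set"
    assume U: "U \<in> {U. A \<subseteq> (\<Union>i. U i) \<and> (\<forall>i. bounded (U i) \<and> diameter (U i) \<le> min \<delta> 1)}"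
    then have "(\<Sum>i. diam_pow t (U i)) \<le> (\<Sum>i. diam_pow s (U i))"
      by (intro suminf_le diam_pow_antimono assms) auto
    then show "\<exists>V\<in>{U. A \<subseteq> (\<Union>i. U i) \<and> (\<forall>i. bounded (U i) \<and> diameter (U i) \<le> \<delta>)}.
        (\<Sum>i. diam_pow t (V i)) \<le> (\<Sum>i. diam_pow s (U i))"
      using U by auto
  qed
  also have "\<dots> = 0"
    using assms(1) \<open>\<delta> > 0\<close> unfolding hausdorff_measure_eq_0_iff by auto
  finally show "hausdorff_content t \<delta> A = 0" by simp
qed

section \<open>Countable subadditivity\<close>

lemma hausdorff_content_le_sum:
  assumes "A \<subseteq> (\<Union>i. U i)" "\<And>i. bounded (U i)" "\<And>i. diameter (U i) \<le> \<delta>"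
  shows "hausdorff_content s \<delta> A \<le> (\<Sum>i. diam_pow s (U i))"
  unfolding hausdorff_content_def by (rule INF_lower) (use assms in auto)

lemma hausdorff_content_UN_le:
  fixes A :: "nat \<Rightarrow> 'a::metric_space set"
  shows "hausdorff_content s \<delta> (\<Union>k. A k) \<le> (\<Sum>k. hausdorff_content s \<delta> (A k))"
proof (rule ennreal_le_epsilon)
  fix e :: real assume "0 < e" and fin: "(\<Sum>k. hausdorff_content s \<delta> (A k)) < top"
  have "\<exists>U. A k \<subseteq> (\<Union>i. U i) \<and> (\<forall>i. bounded (U i) \<and> diameter (U i) \<le> \<delta>) \<and>
      (\<Sum>i. diam_pow s (U i)) \<le> hausdorff_content s \<delta> (A k) + ennreal (e * (1/2) ^ Suc k)" for k
  proof -
    \<comment> \<open>Only a finite content becomes strictly larger when a positive amount is added;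
      the strict inequality then provides a nearly optimal cover.\<close>
    have "hausdorff_content s \<delta> (A k) \<noteq> top"
      using fin ennreal_suminf_lessD less_top by blast
    then have "hausdorff_content s \<delta> (A k) < hausdorff_content s \<delta> (A k) + ennreal (e * (1/2) ^ Suc k)"
      using \<open>0 < e\<close> by (auto simp: ennreal_zero_less_mult_iff ennreal_mult' intro!: ennreal_add_left_cancel_less[THEN iffD2, of _ 0, simplified])
    then show ?thesis
      unfolding hausdorff_content_def INF_less_iff by (auto intro: less_imp_le)
  qed
  then obtain U where U: "\<And>k. A k \<subseteq> (\<Union>i. U k i)" "\<And>k i. bounded (U k i)"
      "\<And>k i. diameter (U k i) \<le> \<delta>"
      "\<And>k. (\<Sum>i. diam_pow s (U k i)) \<le> hausdorff_content s \<delta> (A k) + ennreal (e * (1/2) ^ Suc k)"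
    by metis
  define V where "V n = case_prod U (prod_decode n)" for n
  have "(\<Union>k. A k) \<subseteq> (\<Union>n. V n)"
  proof
    fix x assume "x \<in> (\<Union>k. A k)"
    then obtain k i where "x \<in> U k i" using U(1) by blast
    then have "x \<in> V (prod_encode (k, i))" by (simp add: V_def)
    then show "x \<in> (\<Union>n. V n)" by blast
  qed
  then have "hausdorff_content s \<delta> (\<Union>k. A k) \<le> (\<Sum>n. diam_pow s (V n))"
    by (rule hausdorff_content_le_sum) (auto simp: V_def U split: prod.split)
  also have "\<dots> = (\<Sum>n. case_prod (\<lambda>k i. diam_pow s (U k i)) (prod_decode n))"
    by (simp add: V_def case_prod_unfold)
  also have "\<dots> = (\<Sum>k. \<Sum>i. diam_pow s (U k i))"
    by (rule suminf_ennreal_2dimen) simp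
  also have "\<dots> \<le> (\<Sum>k. hausdorff_content s \<delta> (A k) + ennreal (e * (1/2) ^ Suc k))"
    by (intro suminf_le U) auto
  also have "\<dots> = (\<Sum>k. hausdorff_content s \<delta> (A k)) + (\<Sum>k. ennreal (e * (1/2) ^ Suc k))"
    by (rule suminf_add[symmetric]) auto
  also have "(\<Sum>k. ennreal (e * (1/2) ^ Suc k)) = ennreal e"
    using sums_mult[OF power_half_series, of e] \<open>0 < e\<close>
    by (intro suminf_ennreal_eq) auto
  finally show "hausdorff_content s \<delta> (\<Union>k. A k) \<le> (\<Sum>k. hausdorff_content s \<delta> (A k)) + ennreal e" .
qed

lemma hausdorff_measure_UN_eq_0:
  fixes A :: "nat \<Rightarrow> 'a::metric_space set"
  assumes "\<And>k. hausdorff_measure s (A k) = 0"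
  shows "hausdorff_measure s (\<Union>k. A k) = 0"
  unfolding hausdorff_measure_eq_0_iff
proof (intro allI impI)
  fix \<delta> :: real assume "\<delta> > 0"
  then have "hausdorff_content s \<delta> (A k) = 0" for k
    using assms unfolding hausdorff_measure_eq_0_iff by blast
  then show "hausdorff_content s \<delta> (\<Union>k. A k) = 0"
    using hausdorff_content_UN_le[of s \<delta> A] by simp
qed

section \<open>Upper bound for the dimension of plane sets\<close>

lemma hausdorff_measure_square_eq_0:
  assumes "2 < s"
  shows "hausdorff_measure s (cbox a (a + Complex 1 1)) = 0"
  unfolding hausdorff_measure_eq_0_iff
proof (intro allI impI)
  fix \<delta> :: real assume "\<delta> > 0"
  \<comment> \<open>With N = \<open>Suc n\<close>, a square of side 1/N has diameter at most 2/N, as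
    the norm is at most |Re| + |Im|. The N^2 squares contribute at most N^2 (2/N)^s, which tends to
    0 for s > 2.\<close>
  define D :: "nat \<Rightarrow> real" where "D n = 2 / real (Suc n)" for n
  have le: "hausdorff_content s \<delta> (cbox a (a + Complex 1 1)) \<le> ennreal ((Suc n)^2 * D n powr s)"
    if n: "D n \<le> \<delta>" for n
  proof -
    define N where "N = Suc n"
    define p where "p i = a + Complex (real (i div N) / real N) (real (i mod N) / real N)" for i
    define U where "U i = (if i < N^2 then cbox (p i) (p i + Complex (1/N) (1/N)) else {})" for i
    have "N > 0" by (simp add: N_def)
    have diam: "bounded (U i)" "diameter (U i) \<le> D n" for i
    proof -
      have "norm (x - y) \<le> D n" if "x \<in> U i" "y \<in> U i" for x y
      proof -
        have "\<bar>Re (x - y)\<bar> \<le> 1/N" "\<bar>Im (x - y)\<bar> \<le> 1/N"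
          using that by (auto simp: U_def in_cbox_complex_iff split: if_splits)
        then show ?thesis
          using cmod_le[of "x - y"] by (simp add: D_def N_def)
      qed
      then show "diameter (U i) \<le> D n"
        by (intro diameter_le) (auto simp: D_def)
      show "bounded (U i)" by (auto simp: U_def)
    qed
    have "cbox a (a + Complex 1 1) \<subseteq> (\<Union>i. U i)"
    proof
      fix z assume z: "z \<in> cbox a (a + Complex 1 1)"
      have coord: "\<exists>j<N. real j / N \<le> t \<and> t \<le> real j / N + 1 / N" if "0 \<le> t" "t \<le> 1" for t :: real
      proof (cases "t = 1")
        \<comment> \<open>At the right end point the floor of \<open>t * N\<close> would be the
          forbidden index N, so the last interval is taken.\<close>
        case True
        then show ?thesis
          using \<open>N > 0\<close> by (intro exI[of _ "N - 1"]) (auto simp: field_simps of_nat_diff)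
      next
        case False
        define j where "j = nat \<lfloor>t * N\<rfloor>"
        have j: "real j = of_int \<lfloor>t * N\<rfloor>" using that by (simp add: j_def)
        have "real j \<le> t * N" "t * N < real j + 1"
          unfolding j by linarith+
        moreover have "t * N < N" using that False \<open>N > 0\<close> by simp
        ultimately have "j < N" by linarith
        with \<open>real j \<le> t * N\<close> \<open>t * N < real j + 1\<close> show ?thesis
          using \<open>N > 0\<close> by (intro exI[of _ j]) (auto simp: field_simps)
      qed
      obtain j where j: "j < N" "real j / N \<le> Re (z - a)" "Re (z - a) \<le> real j / N + 1 / N"
        using coord[of "Re (z - a)"] z by (auto simp: in_cbox_complex_iff)
      obtain k where k: "k < N" "real k / N \<le> Im (z - a)" "Im (z - a) \<le> real k / N + 1 / N"
        using coord[of "Im (z - a)"] z by (auto simp: in_cbox_complex_iff)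
      have "j * N + k < N^2"
      proof -
        have "j * N + k < (j + 1) * N" using k by simp
        also have "\<dots> \<le> N * N" using j by (intro mult_right_mono) auto
        finally show ?thesis by (simp add: power2_eq_square)
      qed
      then have "z \<in> U (j * N + k)"
        using j k by (auto simp: U_def p_def in_cbox_complex_iff)
      then show "z \<in> (\<Union>i. U i)" by blast
    qed
    then have "hausdorff_content s \<delta> (cbox a (a + Complex 1 1)) \<le> (\<Sum>i. diam_pow s (U i))"
      using diam n by (intro hausdorff_content_le_sum) (auto intro: order_trans)
    also have "\<dots> = (\<Sum>i<N^2. diam_pow s (U i))"
      by (rule suminf_finite) (auto simp: U_def diam_pow_def)
    also have "\<dots> \<le> (\<Sum>i<N^2. ennreal (D n powr s))"
      using assms diam by (intro sum_mono) (auto simp: diam_pow_pos intro!: ennreal_leI powr_mono2 diameter_ge_0)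
    also have "\<dots> = ennreal (N^2 * D n powr s)"
      by (simp add: ennreal_mult ennreal_of_nat_eq_real_of_nat)
    finally show ?thesis by (simp add: N_def)
  qed
  have "(\<lambda>n. (Suc n)^2 * D n powr s) = (\<lambda>n. 2 powr s * real (Suc n) powr (2 - s))"
    by (auto simp: D_def powr_divide powr_diff field_simps)
  moreover have "(\<lambda>n. 2 powr s * real (Suc n) powr (2 - s)) \<longlonglongrightarrow> 2 powr s * 0"
    using assms
    by (intro tendsto_mult tendsto_const tendsto_neg_powr filterlim_compose[OF filterlim_real_sequentially filterlim_Suc]) auto
  ultimately have "(\<lambda>n. ennreal ((Suc n)^2 * D n powr s)) \<longlonglongrightarrow> ennreal 0"
    by (intro tendsto_ennrealI) simp
  moreover have "\<forall>\<^sub>F n in sequentially. D n \<le> \<delta>"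
  proof -
    have "D \<longlonglongrightarrow> 0"
      unfolding D_def by (rule LIMSEQ_Suc[OF lim_const_over_n])
    then show ?thesis using \<open>\<delta> > 0\<close> by (auto dest!: order_tendstoD(2) elim: eventually_mono)
  qed
  then have "\<forall>\<^sub>F n in sequentially.
      hausdorff_content s \<delta> (cbox a (a + Complex 1 1)) \<le> ennreal ((Suc n)^2 * D n powr s)"
    by (rule eventually_mono) (rule le)
  ultimately have "hausdorff_content s \<delta> (cbox a (a + Complex 1 1)) \<le> ennreal 0"
    by (intro tendsto_lowerbound) auto
  then show "hausdorff_content s \<delta> (cbox a (a + Complex 1 1)) = 0" by simp
qed

lemma hausdorff_measure_complex_eq_0:
  fixes A :: "complex set"
  assumes "2 < s"
  shows "hausdorff_measure s A = 0"
proof -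
  define Q where
    "Q k = (let (m, n) = (from_nat k :: int \<times> int) in cbox (Complex m n) (Complex m n + Complex 1 1))" for k
  have "z \<in> (\<Union>k. Q k)" for z
  proof -
    have "z \<in> Q (to_nat (\<lfloor>Re z\<rfloor>, \<lfloor>Im z\<rfloor>))"
      by (auto simp: Q_def in_cbox_complex_iff)
    then show ?thesis by blast
  qed
  then have "A \<subseteq> (\<Union>k. Q k)" by blast
  moreover have "hausdorff_measure s (\<Union>k. Q k) = 0"
    using assms
    by (intro hausdorff_measure_UN_eq_0)
       (auto simp: Q_def split: prod.split intro!: hausdorff_measure_square_eq_0)
  ultimately show ?thesis
    using hausdorff_measure_mono_set[of A "\<Union>k. Q k" s] by simp
qed

lemma hausdorff_dim_complex_eq_2:
  fixes A :: "complex set"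
  assumes "\<And>s. 0 < s \<Longrightarrow> s < 2 \<Longrightarrow> hausdorff_measure s A \<noteq> 0"
  shows "hausdorff_dim A = 2"
proof (rule antisym)
  show "hausdorff_dim A \<le> 2"
  proof (rule ennreal_le_epsilon)
    fix e :: real assume "0 < e"
    then have "hausdorff_measure (2 + e) A = 0"
      by (intro hausdorff_measure_complex_eq_0) auto
    then have "hausdorff_dim A \<le> ennreal (2 + e)"
      unfolding hausdorff_dim_def using \<open>0 < e\<close> by (intro Inf_lower CollectI exI[of _ "2 + e"]) auto
    then show "hausdorff_dim A \<le> 2 + ennreal e"
      using \<open>0 < e\<close> by (simp add: ennreal_plus)
  qed
  show "2 \<le> hausdorff_dim A"
    unfolding hausdorff_dim_def
  proof (rule Inf_greatest, clarify)
    fix s :: real assume s: "0 \<le> s" "hausdorff_measure s A = 0"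
    have "\<not> s < 2"
    proof
      assume "s < 2"
      \<comment> \<open>The midpoint of s and 2 is positive even when s = 0, so the hypothesis of
        the lemma applies to it.\<close>
      then have "hausdorff_measure ((s + 2) / 2) A = 0"
        using s by (intro hausdorff_measure_eq_0_mono[OF s(2)]) auto
      then show False using assms[of "(s + 2) / 2"] s \<open>s < 2\<close> by auto
    qed
    then show "2 \<le> ennreal s" by (simp add: numeral_le_ennreal_iff flip: ennreal_numeral)
  qed
qed

section \<open>Expanding maps with full branches\<close>

text \<open>
  A point whose orbit follows an itinerary is located up to the scale \<open>gap n / (\<Prod>j<n. L j)\<close> by the
  first \<open>n\<close> symbols; counting itineraries then replaces the mass distribution principle.
\<close>

locale expanding_itineraries =
  fixes f :: "'a::heine_borel \<Rightarrow> 'a"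
    and W :: "nat \<Rightarrow> 'b set"
    and P :: "nat \<Rightarrow> 'b \<Rightarrow> 'a set"
    and L gap :: "nat \<Rightarrow> real"
  assumes finite_W: "finite (W n)"
    and W_nonempty: "W n \<noteq> {}"
    and compact_P: "w \<in> W n \<Longrightarrow> compact (P n w)"
    and P_nonempty: "w \<in> W n \<Longrightarrow> P n w \<noteq> {}"
    and L_pos: "0 < L n"
    and gap_pos: "0 < gap n"
    and lipschitz: "\<lbrakk>w \<in> W n; x \<in> P n w; y \<in> P n w\<rbrakk> \<Longrightarrow> dist (f x) (f y) \<le> L n * dist x y"
    and separated: "\<lbrakk>w \<in> W n; w' \<in> W n; w \<noteq> w'; x \<in> P n w; y \<in> P n w'\<rbrakk> \<Longrightarrow> gap n \<le> dist x y"
    and full: "\<lbrakk>w \<in> W n; w' \<in> W (Suc n)\<rbrakk> \<Longrightarrow> P (Suc n) w' \<subseteq> f ` P n w"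
begin

text \<open>If two orbits share their pieces before time \<open>n\<close> and lie in different ones
  at time \<open>n\<close>, their starting points are at least this far apart, because
  \<open>f ^^ n\<close> stretches their distance by at most the product of the
  \<open>L j\<close>.\<close>

definition scale :: "nat \<Rightarrow> real" where
  "scale n = gap n / (\<Prod>j<n. L j)"

definition level :: "nat \<Rightarrow> 'a set" where
  "level n = (\<Union>w\<in>W n. P n w)"

text \<open>The time shift \<open>m\<close> serves the inductions, which remove the first step of an
  orbit.\<close>

definition stage :: "nat \<Rightarrow> nat \<Rightarrow> 'a set" where
  "stage m N = {z. \<forall>j<N. (f ^^ j) z \<in> level (m + j)}"

definition limit_set :: "'a set" where
  "limit_set = {z. \<forall>n. (f ^^ n) z \<in> level n}"

lemma scale_pos: "0 < scale n"
  by (simp add: scale_def gap_pos L_pos prod_pos)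

lemma compact_level: "compact (level n)"
  unfolding level_def by (intro compact_UN finite_W compact_P)

lemma continuous_on_level: "continuous_on (level n) f"
proof -
  have "continuous_on (P n w) f" if "w \<in> W n" for w
  proof (rule lipschitz_on_continuous_on)
    show "lipschitz_on (L n) (P n w) f"
      using that L_pos[of n] by (intro lipschitz_onI lipschitz) auto
  qed
  then show ?thesis
    unfolding level_def
    by (intro continuous_on_closed_Union finite_W) (auto intro: compact_imp_closed compact_P)
qed

lemma stage_Suc: "stage m (Suc N) = {z \<in> level m. f z \<in> stage (Suc m) N}"
  by (auto simp: stage_def funpow_swap1 less_Suc_eq_0_disj)

text \<open>Continuity of \<open>f\<close> is available on the levels only, so the preimage is taken
  inside \<open>level m\<close>. The successor excludes \<open>stage m 0\<close>, which is the whole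
  space.\<close>

lemma compact_stage: "compact (stage m (Suc N))"
proof (induction N arbitrary: m)
  case 0
  then show ?case by (simp add: stage_Suc) (simp add: stage_def compact_level)
next
  case (Suc N)
  have "closed (f -` stage (Suc m) (Suc N) \<inter> level m)"
    using continuous_on_level[of m] compact_level[of m] compact_imp_closed[OF Suc.IH[of "Suc m"]]
    by (simp add: continuous_on_closed_vimage compact_imp_closed)
  then have "compact (level m \<inter> (f -` stage (Suc m) (Suc N) \<inter> level m))"
    by (intro compact_Int_closed compact_level)
  also have "level m \<inter> (f -` stage (Suc m) (Suc N) \<inter> level m) = stage m (Suc (Suc N))"
    by (subst stage_Suc) auto
  finally show ?case .
qed

lemma stage_antimono: "N \<le> N' \<Longrightarrow> stage m N' \<subseteq> stage m N"
  by (auto simp: stage_def)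

lemma INT_stage: "(\<Inter>N. stage 0 (Suc N)) = limit_set"
  by (auto simp: stage_def limit_set_def)

section \<open>Realising, separating and counting itineraries\<close>

lemma itinerary_realised:
  assumes "\<And>j. j < Suc N \<Longrightarrow> w (m + j) \<in> W (m + j)"
  shows "\<exists>z. \<forall>j<Suc N. (f ^^ j) z \<in> P (m + j) (w (m + j))"
  using assms
proof (induction N arbitrary: m)
  case 0
  then show ?case using P_nonempty[of "w m" m] by auto
next
  case (Suc N)
  have "\<exists>z. \<forall>j<Suc N. (f ^^ j) z \<in> P (Suc m + j) (w (Suc m + j))"
    using Suc.prems[of "Suc _"] by (intro Suc.IH) simp
  then obtain z where z: "\<And>j. j < Suc N \<Longrightarrow> (f ^^ j) z \<in> P (Suc m + j) (w (Suc m + j))"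
    by blast
  \<comment> \<open>The orbit is built backwards: the point found for the later symbols lies in a
    piece covered by the image of the piece at time \<open>m\<close>.\<close>
  have "P (Suc m) (w (Suc m)) \<subseteq> f ` P m (w m)"
    using Suc.prems[of 0] Suc.prems[of 1] by (intro full) auto
  then obtain y where y: "y \<in> P m (w m)" "f y = z"
    using z[of 0] by auto
  have "(f ^^ j) y \<in> P (m + j) (w (m + j))" if "j < Suc (Suc N)" for j
    using that y z[of "j - 1"] by (cases j) (auto simp: funpow_swap1)
  then show ?case by blast
qed

lemma orbit_lipschitz:
  assumes "\<And>j. j < n \<Longrightarrow> w j \<in> W j \<and> (f ^^ j) x \<in> P j (w j) \<and> (f ^^ j) y \<in> P j (w j)"
  shows "dist ((f ^^ n) x) ((f ^^ n) y) \<le> (\<Prod>j<n. L j) * dist x y"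
  using assms
proof (induction n)
  case (Suc n)
  have "dist ((f ^^ Suc n) x) ((f ^^ Suc n) y) \<le> L n * dist ((f ^^ n) x) ((f ^^ n) y)"
    using lipschitz[of "w n" n] Suc.prems[of n] by simp
  also have "\<dots> \<le> L n * ((\<Prod>j<n. L j) * dist x y)"
    using Suc.IH Suc.prems less_imp_le[OF L_pos[of n]] by (intro mult_left_mono) auto
  finally show ?case by (simp add: mult_ac)
qed simp

text \<open>At the first index j of disagreement the earlier pieces are common, so the distance of
  the j-th iterates is less than the product of the earlier \<open>L i\<close> times
  \<open>scale j\<close>, that is, less than \<open>gap j\<close>. This contradicts
  separation.\<close>

lemma itineraries_agree:
  assumes x: "\<And>j. j < n \<Longrightarrow> v j \<in> W j \<and> (f ^^ j) x \<in> P j (v j)"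
    and y: "\<And>j. j < n \<Longrightarrow> w j \<in> W j \<and> (f ^^ j) y \<in> P j (w j)"
    and close: "\<And>j. j < n \<Longrightarrow> dist x y < scale j"
    and "j < n"
  shows "v j = w j"
  using \<open>j < n\<close>
proof (induction j rule: less_induct)
  case (less j)
  show ?case
  proof (rule ccontr)
    assume "v j \<noteq> w j"
    then have "gap j \<le> dist ((f ^^ j) x) ((f ^^ j) y)"
      using x y less.prems by (intro separated[of "v j" j "w j"]) auto
    also have "\<dots> \<le> (\<Prod>i<j. L i) * dist x y"
    proof (rule orbit_lipschitz)
      fix i assume "i < j"
      with less have "v i = w i" "i < n" by auto
      then show "v i \<in> W i \<and> (f ^^ i) x \<in> P i (v i) \<and> (f ^^ i) y \<in> P i (v i)"
        using x[of i] y[of i] by auto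
    qed
    also have "\<dots> < (\<Prod>i<j. L i) * scale j"
      using close[OF less.prems] by (intro mult_strict_left_mono prod_pos) (auto simp: L_pos)
    also have "\<dots> = gap j"
      using prod_pos[of "{..<j}" L] L_pos by (simp add: scale_def less_imp_neq[symmetric])
    finally show False by simp
  qed
qed

text \<open>A member of \<open>A\<close> is determined by its symbols from \<open>n\<close> on, so
  \<open>A\<close> has at most as many members as there are tails. Multiplying by the number of
  heads avoids a division.\<close>

lemma card_itineraries_le:
  assumes "n \<le> N" "A \<subseteq> PiE {..<N} W"
    and agree: "\<And>v w j. v \<in> A \<Longrightarrow> w \<in> A \<Longrightarrow> j < n \<Longrightarrow> v j = w j"
  shows "card A * (\<Prod>j<n. card (W j)) \<le> (\<Prod>j<N. card (W j))"
proof -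
  have "inj_on (\<lambda>v. restrict v {n..<N}) A"
  proof (rule inj_onI)
    fix v w assume vw: "v \<in> A" "w \<in> A" "restrict v {n..<N} = restrict w {n..<N}"
    show "v = w"
    proof (rule PiE_ext)
      show "v \<in> PiE {..<N} W" "w \<in> PiE {..<N} W" using vw assms by auto
      fix j assume "j \<in> {..<N}"
      then show "v j = w j"
        using agree[OF vw(1,2), of j] fun_cong[OF vw(3), of j] by (cases "j < n") auto
    qed
  qed
  moreover have "(\<lambda>v. restrict v {n..<N}) ` A \<subseteq> PiE {n..<N} W"
    using assms(2) by (fastforce simp: PiE_iff)
  ultimately have "card A \<le> card (PiE {n..<N} W)"
    by (intro card_inj_on_le finite_PiE) (auto simp: finite_W)
  also have "\<dots> = (\<Prod>j=n..<N. card (W j))" by (simp add: card_PiE)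
  finally have "card A * (\<Prod>j<n. card (W j)) \<le> (\<Prod>j=n..<N. card (W j)) * (\<Prod>j<n. card (W j))"
    by (intro mult_right_mono) auto
  also have "\<dots> = (\<Prod>j<N. card (W j))"
    using prod.atLeastLessThan_concat[of 0 n N "\<lambda>j. card (W j)"] \<open>n \<le> N\<close>
    by (simp add: lessThan_atLeast0 mult.commute)
  finally show ?thesis .
qed

text \<open>All itineraries of one large length get equal weight, and each is represented by a point
  realising it. By \<open>mass\<close>, the set \<open>V i\<close> contains the representatives of
  at most the share \<open>K * q i powr s\<close>, so the shares of finitely many sets catching all
  of them add up to at least 1.\<close>

lemma open_cover_lower_bound:
  fixes V :: "nat \<Rightarrow> 'a set" and q :: "nat \<Rightarrow> real"
  assumes "0 < s" "0 < K"
    and mass: "\<And>n. 1 \<le> K * (\<Prod>j<n. real (card (W j))) * scale n powr s"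
    and small: "\<And>d. 0 < d \<Longrightarrow> \<exists>n. scale n < d"
    and cover: "limit_set \<subseteq> (\<Union>i. V i)"
    and V: "\<And>i. open (V i)" "\<And>i. 0 < q i" "\<And>i x y. \<lbrakk>x \<in> V i; y \<in> V i\<rbrakk> \<Longrightarrow> dist x y < q i"
  obtains F where "finite F" "1 \<le> (\<Sum>i\<in>F. K * q i powr s)"
proof -
  \<comment> \<open>Otherwise the compact stages minus the cover would be nested and nonempty, and a
    common point would be an uncovered point of the limit set.\<close>
  have "\<exists>N. stage 0 (Suc N) \<subseteq> (\<Union>i. V i)"
  proof (rule ccontr)
    assume *: "\<nexists>N. stage 0 (Suc N) \<subseteq> (\<Union>i. V i)"
    have "\<Inter>(range (\<lambda>N. stage 0 (Suc N) - (\<Union>i. V i))) \<noteq> {}"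
    proof (rule compact_nest)
      show "compact (stage 0 (Suc N) - (\<Union>i. V i))" for N
        by (intro compact_diff compact_stage open_UN) (auto simp: V)
      show "stage 0 (Suc N) - (\<Union>i. V i) \<noteq> {}" for N using * by blast
      show "stage 0 (Suc n) - (\<Union>i. V i) \<subseteq> stage 0 (Suc m) - (\<Union>i. V i)" if "m \<le> n" for m n
        using stage_antimono[of "Suc m" "Suc n" 0] that by blast
    qed
    then obtain z where "z \<in> (\<Inter>N. stage 0 (Suc N) - (\<Union>i. V i))" by blast
    then have "z \<in> (\<Inter>N. stage 0 (Suc N))" "z \<notin> (\<Union>i. V i)" by auto
    then show False using cover unfolding INT_stage by blast
  qed
  then obtain N0 where N0: "stage 0 (Suc N0) \<subseteq> (\<Union>i. V i)" by blast
  obtain F where F: "finite F" "stage 0 (Suc N0) \<subseteq> (\<Union>i\<in>F. V i)"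
    using compactE_image[OF compact_stage[of 0 N0], of UNIV V] N0 V by auto
  \<comment> \<open>The scales need not decrease, hence the least index: all earlier scales are at
    least \<open>q i\<close>, so points of \<open>V i\<close> share their first \<open>n i\<close>
    symbols.\<close>
  define n where "n i = (LEAST k. scale k < q i)" for i
  have n: "scale (n i) < q i" "j < n i \<Longrightarrow> q i \<le> scale j" for i j
    unfolding n_def using LeastI_ex[OF small[OF V(2)[of i]]] not_less_Least[of j "\<lambda>k. scale k < q i"]
    by (auto simp: not_less)
  \<comment> \<open>Large enough to bound every \<open>n i\<close> and to make the stage used one of
    those that are covered.\<close>
  define N where "N = (\<Sum>i\<in>F. n i) + N0"
  have n_le: "n i \<le> Suc N" if "i \<in> F" for i
    using member_le_sum[OF that, of n] F(1) by (simp add: N_def)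
  define \<Omega> where "\<Omega> = PiE {..<Suc N} W"
  have "finite \<Omega>" unfolding \<Omega>_def by (intro finite_PiE) (auto simp: finite_W)
  have card_\<Omega>: "card \<Omega> = (\<Prod>j<Suc N. card (W j))" by (simp add: \<Omega>_def card_PiE)
  have card_pos: "0 < (\<Prod>j<k. card (W j))" for k
    by (simp add: prod_pos card_gt_0_iff finite_W W_nonempty)
  have "\<exists>z. \<forall>j<Suc N. (f ^^ j) z \<in> P j (w j)" if "w \<in> \<Omega>" for w
    using itinerary_realised[of N w 0] that by (auto simp: \<Omega>_def PiE_iff)
  then obtain z where z: "\<And>w j. w \<in> \<Omega> \<Longrightarrow> j < Suc N \<Longrightarrow> (f ^^ j) (z w) \<in> P j (w j)"
    by metis
  define A where "A i = {w \<in> \<Omega>. z w \<in> V i}" for i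
  have "\<Omega> \<subseteq> (\<Union>i\<in>F. A i)"
  proof
    fix w assume "w \<in> \<Omega>"
    then have "z w \<in> stage 0 (Suc N)"
      using z[of w] by (auto simp: stage_def level_def \<Omega>_def PiE_iff)
    also have "\<dots> \<subseteq> stage 0 (Suc N0)" by (rule stage_antimono) (simp add: N_def)
    also note F(2)
    finally show "w \<in> (\<Union>i\<in>F. A i)" using \<open>w \<in> \<Omega>\<close> by (auto simp: A_def)
  qed
  then have "card \<Omega> \<le> (\<Sum>i\<in>F. card (A i))"
    using card_mono[of "\<Union>i\<in>F. A i" \<Omega>] card_UN_le[OF F(1), of A] F(1) \<open>finite \<Omega>\<close>
    by (force simp: A_def)
  then have "real (card \<Omega>) \<le> (\<Sum>i\<in>F. real (card (A i)))"
    by (simp flip: of_nat_sum)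
  also have "\<dots> \<le> (\<Sum>i\<in>F. real (card \<Omega>) * (K * q i powr s))"
  proof (rule sum_mono)
    fix i assume "i \<in> F"
    have "card (A i) * (\<Prod>j<n i. card (W j)) \<le> card \<Omega>"
      unfolding card_\<Omega>
    proof (rule card_itineraries_le)
      show "n i \<le> Suc N" using n_le[OF \<open>i \<in> F\<close>] .
      show "A i \<subseteq> PiE {..<Suc N} W" by (auto simp: A_def \<Omega>_def)
      fix v w j assume vw: "v \<in> A i" "w \<in> A i" and "j < n i"
      show "v j = w j"
      proof (rule itineraries_agree[of "n i" v "z v" w "z w"])
        fix j assume "j < n i"
        then have "j < Suc N" using \<open>n i \<le> Suc N\<close> by simp
        then show "v j \<in> W j \<and> (f ^^ j) (z v) \<in> P j (v j)" "w j \<in> W j \<and> (f ^^ j) (z w) \<in> P j (w j)"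
          using vw z[of v j] z[of w j] by (auto simp: A_def \<Omega>_def PiE_iff)
        have "dist (z v) (z w) < q i" using vw V(3) by (auto simp: A_def)
        also have "\<dots> \<le> scale j" using n(2)[OF \<open>j < n i\<close>] .
        finally show "dist (z v) (z w) < scale j" .
      qed fact
    qed
    then have "real (card (A i)) * (\<Prod>j<n i. real (card (W j))) \<le> card \<Omega>"
      by (simp flip: of_nat_prod of_nat_mult)
    \<comment> \<open>The mass bound at the index \<open>n i\<close> trades the number of heads for
      the scale, which is then replaced by the larger \<open>q i\<close>.\<close>
    have "real (card (A i)) \<le> real (card (A i)) * (K * (\<Prod>j<n i. real (card (W j))) * scale (n i) powr s)"
      using mass[of "n i"] mult_left_mono[of 1 _ "real (card (A i))"] by simp
    also have "\<dots> = real (card (A i)) * (\<Prod>j<n i. real (card (W j))) * (K * scale (n i) powr s)"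
      by simp
    also have "\<dots> \<le> card \<Omega> * (K * scale (n i) powr s)"
      by (rule mult_right_mono) (fact, simp add: less_imp_le \<open>0 < K\<close>)
    also have "\<dots> \<le> card \<Omega> * (K * q i powr s)"
      using \<open>0 < K\<close> \<open>0 < s\<close> n(1)[of i] scale_pos[of "n i"]
      by (intro mult_left_mono powr_mono2) auto
    finally show "real (card (A i)) \<le> real (card \<Omega>) * (K * q i powr s)" .
  qed
  finally have "real (card \<Omega>) * 1 \<le> real (card \<Omega>) * (\<Sum>i\<in>F. K * q i powr s)"
    by (simp add: sum_distrib_left)
  moreover have "0 < real (card \<Omega>)" using card_pos[of "Suc N"] card_\<Omega> by (simp only: of_nat_0_less_iff)
  ultimately have "1 \<le> (\<Sum>i\<in>F. K * q i powr s)" by (simp only: mult_le_cancel_left_pos)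
  with F(1) show ?thesis by (rule that)
qed

text \<open>A cover of small total contribution can be thickened to an open cover whose total is
  still small, against the lower bound for open covers.\<close>

theorem hausdorff_measure_limit_set_nonzero:
  assumes "0 < s" "0 < K"
    and mass: "\<And>n. 1 \<le> K * (\<Prod>j<n. real (card (W j))) * scale n powr s"
    and small: "\<And>d. 0 < d \<Longrightarrow> \<exists>n. scale n < d"
  shows "hausdorff_measure s limit_set \<noteq> 0"
proof
  assume "hausdorff_measure s limit_set = 0"
  then have "hausdorff_content s 1 limit_set = 0"
    unfolding hausdorff_measure_eq_0_iff by simp
  \<comment> \<open>Chosen so that \<open>K * 4 powr s * (2 * \<eta>)\<close> equals 1/2, below the
    value 1 that the open cover must reach.\<close>
  define \<eta> where "\<eta> = 1 / (4 * (K * 4 powr s))"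
  have "\<eta> > 0" using \<open>0 < K\<close> by (simp add: \<eta>_def)
  then have "hausdorff_content s 1 limit_set < ennreal \<eta>"
    using \<open>hausdorff_content s 1 limit_set = 0\<close> by simp
  then obtain U where U: "limit_set \<subseteq> (\<Union>i. U i)" "\<And>i. bounded (U i)"
    and sum_U: "(\<Sum>i. diam_pow s (U i)) < ennreal \<eta>"
    unfolding hausdorff_content_def INF_less_iff by auto
  define d where "d i = diameter (U i)" for i
  have d_nonneg: "0 \<le> d i" for i unfolding d_def using U(2) by (rule diameter_ge_0)
  \<comment> \<open>Positive radii make \<open>q i\<close> positive even where \<open>U i\<close> is
    empty or a single point; their s-th powers form a geometric series with sum
    \<open>\<eta>\<close>.\<close>
  define e where "e i = (\<eta> * (1/2) ^ Suc i) powr (1 / s)" for i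
  have e_pos: "0 < e i" for i using \<open>\<eta> > 0\<close> by (simp add: e_def)
  have e_powr: "e i powr s = \<eta> * (1/2) ^ Suc i" for i
    using \<open>\<eta> > 0\<close> \<open>0 < s\<close> unfolding e_def by (subst powr_powr) simp
  define V where "V i = (\<Union>x\<in>U i. ball x (e i))" for i
  define q where "q i = d i + 2 * e i" for i
  have q_powr: "q i powr s \<le> 4 powr s * (d i powr s + e i powr s)" for i
  proof -
    have "q i powr s \<le> (4 * max (d i) (e i)) powr s"
      using d_nonneg[of i] e_pos[of i] \<open>0 < s\<close> by (intro powr_mono2) (auto simp: q_def)
    also have "\<dots> = 4 powr s * max (d i) (e i) powr s"
      by (rule powr_mult)
    also have "max (d i) (e i) powr s \<le> d i powr s + e i powr s" by (auto simp: max_def)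
    finally show ?thesis by simp
  qed
  obtain F where F: "finite F" "1 \<le> (\<Sum>i\<in>F. K * q i powr s)"
  proof (rule open_cover_lower_bound[OF assms])
    show "limit_set \<subseteq> (\<Union>i. V i)"
      using U(1) e_pos by (force simp: V_def)
    show "open (V i)" for i unfolding V_def by blast
    show "0 < q i" for i using d_nonneg[of i] e_pos[of i] by (simp add: q_def)
    fix i x y assume "x \<in> V i" "y \<in> V i"
    then obtain a b where ab: "a \<in> U i" "dist a x < e i" "b \<in> U i" "dist b y < e i"
      by (auto simp: V_def)
    have "dist x y \<le> dist a x + dist a b + dist b y"
      using dist_triangle[of x y a] dist_triangle[of a y b] by (simp add: dist_commute)
    also have "dist a b \<le> d i" unfolding d_def using U(2) ab by (intro diameter_bounded_bound) auto
    finally show "dist x y < q i" using ab by (simp add: q_def)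
  qed
  have "(\<Sum>i\<in>F. d i powr s) \<le> \<eta>"
  proof -
    have "ennreal (\<Sum>i\<in>F. d i powr s) = (\<Sum>i\<in>F. diam_pow s (U i))"
      using \<open>0 < s\<close> by (simp add: diam_pow_pos d_def)
    also have "\<dots> \<le> (\<Sum>i. diam_pow s (U i))" by (rule sum_le_suminf) (auto intro: F)
    also note sum_U
    finally show ?thesis using \<open>\<eta> > 0\<close> by (simp add: ennreal_less_iff sum_nonneg less_imp_le)
  qed
  moreover have "(\<Sum>i\<in>F. e i powr s) \<le> \<eta>"
  proof -
    have "(\<lambda>i. \<eta> * (1/2) ^ Suc i) sums (\<eta> * 1)" by (rule sums_mult[OF power_half_series])
    then have "(\<Sum>i. \<eta> * (1/2) ^ Suc i) = \<eta>" "summable (\<lambda>i. \<eta> * (1/2) ^ Suc i)"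
      by (simp_all only: sums_iff mult_1_right)
    moreover have "(\<Sum>i\<in>F. \<eta> * (1/2) ^ Suc i) \<le> (\<Sum>i. \<eta> * (1/2) ^ Suc i)"
      using \<open>\<eta> > 0\<close> by (intro sum_le_suminf calculation(2) F(1)) auto
    ultimately show ?thesis unfolding e_powr by simp
  qed
  ultimately have "(\<Sum>i\<in>F. d i powr s + e i powr s) \<le> 2 * \<eta>" by (simp add: sum.distrib)
  have "1 \<le> (\<Sum>i\<in>F. K * (4 powr s * (d i powr s + e i powr s)))"
    using F(2) by (rule order_trans) (intro sum_mono mult_left_mono q_powr less_imp_le \<open>0 < K\<close>)
  also have "\<dots> = K * 4 powr s * (\<Sum>i\<in>F. d i powr s + e i powr s)"
    by (simp only: sum_distrib_left mult.assoc)
  also have "\<dots> \<le> K * 4 powr s * (2 * \<eta>)"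
    by (rule mult_left_mono) (fact, simp add: less_imp_le \<open>0 < K\<close>)
  also have "\<dots> = 1 / 2" using \<open>0 < K\<close> by (simp add: \<eta>_def)
  finally show False by simp
qed

end

section \<open>The Weierstrass function near lattice points\<close>

lemma summable_on_int_powr:
  fixes a :: real
  assumes "1 < a"
  shows "(\<lambda>m::int. 1 / (1 + \<bar>of_int m\<bar>) powr a) summable_on UNIV"
proof -
  have nat: "(\<lambda>n::nat. 1 / (1 + real n) powr a) summable_on UNIV"
  proof (rule norm_summable_imp_summable_on)
    have "summable (\<lambda>n. real (Suc n) powr - a)"
      using assms by (subst summable_Suc_iff) (simp add: summable_real_powr_iff)
    then show "summable (\<lambda>n. norm (1 / (1 + real n) powr a))"
      by (simp add: powr_minus_divide add.commute)
  qed
  have "(\<lambda>m::int. 1 / (1 + \<bar>of_int m\<bar>) powr a) summable_on range int"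
    by (subst summable_on_reindex) (auto simp: o_def nat)
  moreover have "(\<lambda>m::int. 1 / (1 + \<bar>of_int m\<bar>) powr a) summable_on range (\<lambda>n. - int n)"
    by (subst summable_on_reindex) (auto simp: o_def nat inj_def)
  ultimately have "(\<lambda>m::int. 1 / (1 + \<bar>of_int m\<bar>) powr a) summable_on (range int \<union> range (\<lambda>n. - int n))"
    by (rule summable_on_union)
  moreover have "range int \<union> range (\<lambda>n. - int n) = UNIV"
    by (metis (no_types, lifting) UNIV_eq_I UnI1 UnI2 int_cases2 rangeI)
  ultimately show ?thesis by simp
qed

text \<open>For \<open>w2 = 0\<close> every nonzero \<open>w1\<close> would satisfy the second
  assumption, although the lattice would have rank one.\<close>

locale rank_two_lattice =
  fixes w1 w2 :: complex
  assumes w2_nonzero: "w2 \<noteq> 0"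
    and independent: "\<nexists>r::real. w1 = of_real r * w2"
begin

abbreviation \<Lambda> :: "complex set" where "\<Lambda> \<equiv> period_lattice w1 w2"

section \<open>Discreteness of the lattice and convergence of the series\<close>

lemma add_in_lattice: "v \<in> \<Lambda> \<Longrightarrow> w \<in> \<Lambda> \<Longrightarrow> v + w \<in> \<Lambda>"
proof -
  assume "v \<in> \<Lambda>" "w \<in> \<Lambda>"
  then obtain m n k l :: int where "v = of_int m * w1 + of_int n * w2" "w = of_int k * w1 + of_int l * w2"
    by (auto simp: period_lattice_def)
  then have "v + w = of_int (m + k) * w1 + of_int (n + l) * w2" by (simp add: algebra_simps)
  then show ?thesis unfolding period_lattice_def by blast
qed

lemma uminus_in_lattice: "w \<in> \<Lambda> \<Longrightarrow> - w \<in> \<Lambda>"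
proof -
  assume "w \<in> \<Lambda>"
  then obtain m n :: int where "w = of_int m * w1 + of_int n * w2" by (auto simp: period_lattice_def)
  then have "- w = of_int (- m) * w1 + of_int (- n) * w2" by simp
  then show ?thesis unfolding period_lattice_def by blast
qed

lemma diff_in_lattice: "v \<in> \<Lambda> \<Longrightarrow> w \<in> \<Lambda> \<Longrightarrow> v - w \<in> \<Lambda>"
  using add_in_lattice[of v "- w"] uminus_in_lattice by simp

text \<open>Division by \<open>w2\<close> turns a lattice point into m \<tau> + n with \<tau> not
  real. The imaginary part m Im \<tau> controls m, and then the triangle inequality controls n.
  Discreteness, injectivity and summability all come from this bound.\<close>

lemma coefficients_bound:
  obtains K where "0 < K" "\<And>m n :: int. \<bar>real_of_int m\<bar> + \<bar>real_of_int n\<bar> \<le> K * norm (of_int m * w1 + of_int n * w2)"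
proof
  define \<tau> where "\<tau> = w1 / w2"
  have w1: "w1 = \<tau> * w2" using w2_nonzero by (simp add: \<tau>_def)
  have "Im \<tau> \<noteq> 0"
  proof
    assume "Im \<tau> = 0"
    then have "\<tau> = of_real (Re \<tau>)" by (simp add: complex_eq_iff)
    then show False using independent w1 by metis
  qed
  define B where "B = 1 + (1 + norm \<tau>) / \<bar>Im \<tau>\<bar>"
  have "B > 0" by (auto simp: B_def intro!: add_pos_nonneg)
  then show "0 < B / norm w2" using w2_nonzero by simp
  fix m n :: int
  define z where "z = of_int m * \<tau> + of_int n"
  have "\<bar>m\<bar> * \<bar>Im \<tau>\<bar> = \<bar>Im z\<bar>" by (simp add: z_def abs_mult)
  also have "\<dots> \<le> norm z" by (rule abs_Im_le_cmod)
  finally have m: "\<bar>real_of_int m\<bar> \<le> norm z / \<bar>Im \<tau>\<bar>"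
    using \<open>Im \<tau> \<noteq> 0\<close> by (simp add: pos_le_divide_eq)
  have "\<bar>real_of_int n\<bar> = norm (z - of_int m * \<tau>)" by (simp add: z_def)
  also have "\<dots> \<le> norm z + \<bar>m\<bar> * norm \<tau>"
    using norm_triangle_ineq4[of z "of_int m * \<tau>"] by (simp add: norm_mult)
  finally have "\<bar>real_of_int m\<bar> + \<bar>real_of_int n\<bar> \<le> norm z + \<bar>m\<bar> * (1 + norm \<tau>)"
    by (simp add: algebra_simps)
  also have "\<dots> \<le> norm z + norm z / \<bar>Im \<tau>\<bar> * (1 + norm \<tau>)"
    using m by (intro add_left_mono mult_right_mono) auto
  also have "\<dots> = B * norm z" by (simp add: B_def algebra_simps)
  also have "norm z = norm (of_int m * w1 + of_int n * w2) / norm w2"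
    using w2_nonzero by (simp add: z_def w1 algebra_simps flip: norm_divide)
      (simp add: add_divide_distrib)
  finally show "\<bar>real_of_int m\<bar> + \<bar>real_of_int n\<bar> \<le> B / norm w2 * norm (of_int m * w1 + of_int n * w2)"
    by simp
qed

lemma lattice_eq_image: "\<Lambda> = (\<lambda>(m, n). of_int m * w1 + of_int n * w2) ` UNIV"
  by (auto simp: period_lattice_def)

lemma inj_coefficients: "inj (\<lambda>(m :: int, n :: int). of_int m * w1 + of_int n * w2)"
proof (rule injI, clarify)
  fix m n k l :: int
  assume eq: "of_int m * w1 + of_int n * w2 = of_int k * w1 + of_int l * w2"
  obtain K where K: "\<And>m n :: int. \<bar>real_of_int m\<bar> + \<bar>real_of_int n\<bar> \<le> K * norm (of_int m * w1 + of_int n * w2)"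
    using coefficients_bound by blast
  have "of_int (m - k) * w1 + of_int (n - l) * w2 = 0" using eq by (simp add: algebra_simps)
  then show "m = k \<and> n = l" using K[of "m - k" "n - l"] by (auto simp: abs_if split: if_splits)
qed

lemma finite_lattice_norm_le: "finite {w \<in> \<Lambda>. norm w \<le> R}"
proof -
  obtain K where K: "0 < K" "\<And>m n :: int. \<bar>real_of_int m\<bar> + \<bar>real_of_int n\<bar> \<le> K * norm (of_int m * w1 + of_int n * w2)"
    using coefficients_bound by blast
  define N where "N = \<lceil>K * R\<rceil>"
  have "{w \<in> \<Lambda>. norm w \<le> R} \<subseteq> (\<lambda>(m, n). of_int m * w1 + of_int n * w2) ` ({-N..N} \<times> {-N..N})"
  proof clarify
    fix w assume "w \<in> \<Lambda>" "norm w \<le> R"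
    then obtain m n :: int where w: "w = of_int m * w1 + of_int n * w2" by (auto simp: period_lattice_def)
    have "\<bar>real_of_int m\<bar> + \<bar>real_of_int n\<bar> \<le> K * R"
      using order_trans[OF K(2)[of m n] mult_left_mono[OF \<open>norm w \<le> R\<close>[unfolded w], of K]] K(1) by simp
    then have "\<bar>m\<bar> \<le> N" "\<bar>n\<bar> \<le> N" unfolding N_def by linarith+
    then show "w \<in> (\<lambda>(m, n). of_int m * w1 + of_int n * w2) ` ({-N..N} \<times> {-N..N})"
      using w by (auto intro!: image_eqI[of _ _ "(m, n)"])
  qed
  then show ?thesis by (rule finite_subset) auto
qed

lemma lattice_gap:
  obtains \<delta> where "0 < \<delta>" "\<And>w. w \<in> \<Lambda> \<Longrightarrow> w \<noteq> 0 \<Longrightarrow> \<delta> \<le> norm w"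
proof -
  obtain K where K: "0 < K" "\<And>m n :: int. \<bar>real_of_int m\<bar> + \<bar>real_of_int n\<bar> \<le> K * norm (of_int m * w1 + of_int n * w2)"
    using coefficients_bound by blast
  have "1 / K \<le> norm w" if "w \<in> \<Lambda>" "w \<noteq> 0" for w
  proof -
    obtain m n :: int where w: "w = of_int m * w1 + of_int n * w2"
      using \<open>w \<in> \<Lambda>\<close> by (auto simp: period_lattice_def)
    have "m \<noteq> 0 \<or> n \<noteq> 0" using w \<open>w \<noteq> 0\<close> by auto
    then have "1 \<le> \<bar>real_of_int m\<bar> + \<bar>real_of_int n\<bar>" by linarith
    then show ?thesis using K(2)[of m n] K(1) w by (simp add: field_simps)
  qed
  then show ?thesis using K(1) by (intro that[of "1 / K"]) auto
qed

text \<open>For |m| + |n| at least 1, the product (1 + |m|)(1 + |n|) is at most the square of 2(|m|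
  + |n|). Raising this to the power 3/2 bounds the inverse cubes by a product of two convergent
  one-variable series.\<close>

lemma summable_inverse_cube: "(\<lambda>w. 1 / norm w ^ 3) summable_on (\<Lambda> - {0})"
proof -
  obtain K where K: "0 < K" "\<And>m n :: int. \<bar>real_of_int m\<bar> + \<bar>real_of_int n\<bar> \<le> K * norm (of_int m * w1 + of_int n * w2)"
    using coefficients_bound by blast
  define \<iota> where "\<iota> = (\<lambda>(m :: int, n :: int). of_int m * w1 + of_int n * w2)"
  define b :: "int \<Rightarrow> real" where "b m = 1 / (1 + \<bar>of_int m\<bar>) powr (3/2)" for m
  have b_summable: "b summable_on UNIV" unfolding b_def by (rule summable_on_int_powr) simp
  have "(\<lambda>(m, n). b m * b n) summable_on (UNIV \<times> UNIV)"
  proof (rule summable_on_SigmaI)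
    show "((\<lambda>n. case (m, n) of (m, n) \<Rightarrow> b m * b n) has_sum b m * infsum b UNIV) UNIV" for m
      using b_summable by (auto intro!: has_sum_cmult_right has_sum_infsum)
    show "(\<lambda>m. b m * infsum b UNIV) summable_on UNIV"
      using b_summable by (intro summable_on_cmult_left)
  qed (auto simp: b_def)
  \<comment> \<open>The 8 is the cube of the 2 in that square, and \<open>K ^ 3\<close> comes from
    passing from the coefficients to the norm.\<close>
  then have "(\<lambda>p. 8 * K ^ 3 * (case p of (m, n) \<Rightarrow> b m * b n)) summable_on (UNIV - {(0, 0)})"
    by (intro summable_on_cmult_right) (rule summable_on_subset_banach, auto)
  then have "(\<lambda>p. 1 / norm (\<iota> p) ^ 3) summable_on (UNIV - {(0, 0)})"
  proof (rule summable_on_comparison_test)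
    fix p :: "int \<times> int" assume "p \<in> UNIV - {(0, 0)}"
    then obtain m n where p: "p = (m, n)" "m \<noteq> 0 \<or> n \<noteq> 0" by (cases p) auto
    define x y :: real where "x = \<bar>of_int m\<bar>" and "y = \<bar>of_int n\<bar>"
    have xy: "0 \<le> x" "0 \<le> y" "1 \<le> x + y" using p by (auto simp: x_def y_def)
    have "(x + y) / K \<le> norm (\<iota> p)"
      using K(1) K(2)[of m n] by (simp add: \<iota>_def p x_def y_def field_simps)
    then have "((x + y) / K) ^ 3 \<le> norm (\<iota> p) ^ 3"
      using xy K(1) by (intro power_mono) auto
    moreover have "((1 + x) * (1 + y)) powr (3/2) \<le> 8 * (x + y) ^ 3"
    proof -
      have "0 \<le> (x - y)^2" "0 \<le> x * y" "0 \<le> (x + y) * (x + y - 1)" using xy by auto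
      then have "(1 + x) * (1 + y) \<le> (2 * (x + y))^2"
        using xy by (simp add: power2_eq_square algebra_simps)
      then have "((1 + x) * (1 + y)) powr (3/2) \<le> ((2 * (x + y))^2) powr (3/2)"
        using xy by (intro powr_mono2) auto
      also have "\<dots> = (2 * (x + y)) powr 3"
        using xy powr_powr[of "2 * (x + y)" 2 "3/2"] by simp
      also have "\<dots> = 8 * (x + y) ^ 3" using xy by (simp add: power3_eq_cube algebra_simps)
      finally show ?thesis .
    qed
    ultimately have "((1 + x) * (1 + y)) powr (3/2) \<le> 8 * K ^ 3 * norm (\<iota> p) ^ 3"
      using K(1) by (simp add: field_simps)
    moreover have "0 < norm (\<iota> p) ^ 3"
      using \<open>(x + y) / K \<le> norm (\<iota> p)\<close> xy K(1) by (smt (verit) divide_pos_pos zero_less_power)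
    moreover have "0 < ((1 + x) * (1 + y)) powr (3/2)" using xy by auto
    ultimately have "1 / norm (\<iota> p) ^ 3 \<le> 8 * K ^ 3 * (1 / ((1 + x) * (1 + y)) powr (3/2))"
      by (simp add: divide_simps mult_ac)
    also have "1 / ((1 + x) * (1 + y)) powr (3/2) = b m * b n"
      using xy by (simp add: b_def x_def y_def powr_mult)
    finally show "1 / norm (\<iota> p) ^ 3 \<le> 8 * K ^ 3 * (case p of (m, n) \<Rightarrow> b m * b n)" by (simp add: p)
  qed auto
  moreover have "inj \<iota>" unfolding \<iota>_def by (rule inj_coefficients)
  then have "\<Lambda> - {0} = \<iota> ` (UNIV - {(0, 0)})"
    unfolding lattice_eq_image \<iota>_def by (subst image_set_diff) auto
  ultimately show ?thesis
    using \<open>inj \<iota>\<close> by (simp add: summable_on_reindex inj_on_subset[of _ UNIV] o_def)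
qed

text \<open>Both \<open>u\<close> and \<open>v\<close> stay at distance at least |w|/2 from
  \<open>w\<close>. In the difference of the fractions the factor u + v - 2w is at most 3|w|, and
  the four halves in the denominator give 16, hence 48. The case \<open>v = 0\<close> yields
  convergence, the general case the Lipschitz bound.\<close>

lemma lattice_term_lipschitz:
  fixes u v w :: complex
  assumes "w \<noteq> 0" "2 * norm u \<le> norm w" "2 * norm v \<le> norm w"
  shows "norm (1 / (u - w)^2 - 1 / (v - w)^2) \<le> 48 * norm (u - v) * (1 / norm w ^ 3)"
proof -
  have half: "norm w / 2 \<le> norm (u - w)" "norm w / 2 \<le> norm (v - w)"
    using norm_triangle_ineq2[of w u] norm_triangle_ineq2[of w v] assms by (auto simp: norm_minus_commute)
  have nz: "u - w \<noteq> 0" "v - w \<noteq> 0" "0 < norm w" using half assms(1) by auto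
  have "1 / (u - w)^2 - 1 / (v - w)^2 = (v - u) * (u + v - 2 * w) / ((u - w)^2 * (v - w)^2)"
    using nz by (simp add: field_simps) (simp add: power2_eq_square algebra_simps)
  then have "norm (1 / (u - w)^2 - 1 / (v - w)^2) =
      norm (u - v) * norm (u + v - 2 * w) / (norm (u - w)^2 * norm (v - w)^2)"
    by (simp add: norm_mult norm_divide norm_power norm_minus_commute)
  also have "\<dots> \<le> norm (u - v) * (3 * norm w) / ((norm w / 2)^2 * (norm w / 2)^2)"
  proof (intro frac_le mult_left_mono mult_mono power_mono half)
    have "norm (u + v - 2 * w) \<le> norm u + norm v + 2 * norm w"
      using norm_triangle_ineq4[of "u + v" "2 * w"] norm_triangle_ineq[of u v] by (simp add: norm_mult)
    then show "norm (u + v - 2 * w) \<le> 3 * norm w" using assms by simp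
  qed (use nz in auto)
  also have "\<dots> = 48 * norm (u - v) * (1 / norm w ^ 3)"
    using nz by (simp add: field_simps power_numeral_reduce)
  finally show ?thesis .
qed

text \<open>This holds for lattice points \<open>z\<close> as well: a term \<open>w = z\<close>,
  where division by zero gives a default value, is among the finitely many terms split off.\<close>

lemma summable_lattice_terms:
  "(\<lambda>w. 1 / (z - w)^2 - 1 / w^2) summable_on (\<Lambda> - {0})"
proof -
  define A where "A = {w \<in> \<Lambda> - {0}. 2 * norm z \<le> norm w}"
  have "(\<lambda>w. norm (1 / (z - w)^2 - 1 / w^2)) summable_on A"
  proof (rule summable_on_comparison_test)
    show "(\<lambda>w. 48 * norm z * (1 / norm w ^ 3)) summable_on A"
      by (intro summable_on_cmult_right summable_on_subset_banach[OF summable_inverse_cube]) (auto simp: A_def)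
    show "norm (1 / (z - w)^2 - 1 / w^2) \<le> 48 * norm z * (1 / norm w ^ 3)" if "w \<in> A" for w
      using lattice_term_lipschitz[of w z 0] that by (auto simp: A_def)
  qed auto
  then have "(\<lambda>w. 1 / (z - w)^2 - 1 / w^2) summable_on A"
    by (rule abs_summable_summable)
  moreover have "finite (\<Lambda> - {0} - A)"
    by (rule finite_subset[OF _ finite_lattice_norm_le[of "2 * norm z"]]) (auto simp: A_def)
  ultimately have "(\<lambda>w. 1 / (z - w)^2 - 1 / w^2) summable_on (A \<union> (\<Lambda> - {0} - A))"
    by (intro summable_on_union) auto
  moreover have "A \<union> (\<Lambda> - {0} - A) = \<Lambda> - {0}" by (auto simp: A_def)
  ultimately show ?thesis by simp
qed

section \<open>Periodicity and the local form at lattice points\<close>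

definition regular_part :: "complex \<Rightarrow> complex" where
  "regular_part u = (\<Sum>\<^sub>\<infinity>w\<in>\<Lambda> - {0}. 1 / (u - w)^2 - 1 / w^2)"

lemma regular_part_0: "regular_part 0 = 0"
  by (simp add: regular_part_def)

text \<open>
  Comparing the two series term by term, they differ by the sum
  of \<open>1/(w - v)\<^sup>2 - 1/w\<^sup>2\<close>, which is
  odd under the involution \<open>w \<mapsto> v - w\<close>; no derivative of \<open>\<wp>\<close> is needed.
\<close>

lemma weierstrass_p_periodic:
  assumes "v \<in> \<Lambda>"
  shows "weierstrass_p w1 w2 (z + v) = weierstrass_p w1 w2 z"
proof (cases "v = 0")
  case False
  \<comment> \<open>Without 0 and \<open>v\<close>, both \<open>w\<close> and \<open>w - v\<close>
    are nonzero, so the shift by \<open>v\<close> carries this index set to the one without 0 and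
    \<open>- v\<close>.\<close>
  define S where "S = \<Lambda> - {0, v}"
  define t where "t u w = 1 / (u - w)^2 - 1 / w^2" for u w :: complex
  have sum_t: "t u summable_on (\<Lambda> - {0})" for u
    unfolding t_def by (rule summable_lattice_terms)
  have bij: "bij_betw (\<lambda>w. w - v) S (\<Lambda> - {0, - v})"
    by (rule bij_betw_byWitness[of _ "\<lambda>w. w + v"])
       (use assms in \<open>auto simp: S_def diff_in_lattice add_in_lattice add_eq_0_iff2\<close>)
  have reflect: "bij_betw (\<lambda>w. v - w) S S"
    by (rule bij_betw_byWitness[of _ "\<lambda>w. v - w"]) (use assms in \<open>auto simp: S_def diff_in_lattice\<close>)
  have sum1: "t (z + v) summable_on S"
    by (rule summable_on_subset_banach[OF sum_t]) (auto simp: S_def)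
  have sum2: "(\<lambda>w. t z (w - v)) summable_on S"
    using summable_on_reindex_bij_betw[OF bij, of "t z"] summable_on_subset_banach[OF sum_t[of z], of "\<Lambda> - {0, - v}"]
    by auto
  define T where "T w = 1 / (w - v)^2 - 1 / w^2" for w
  have T: "t (z + v) w = t z (w - v) + T w" for w
    by (simp add: t_def T_def algebra_simps)
  have "T summable_on S"
    using summable_on_add[OF sum1 summable_on_uminus[THEN iffD2, OF sum2]] by (simp add: T)
  have "infsum T S = (\<Sum>\<^sub>\<infinity>w\<in>S. T (v - w))"
    by (rule infsum_reindex_bij_betw[OF reflect, symmetric])
  also have "\<dots> = (\<Sum>\<^sub>\<infinity>w\<in>S. - T w)"
    by (intro infsum_cong) (simp add: T_def power2_commute)
  also have "\<dots> = - infsum T S" by (rule infsum_uminus)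
  finally have "infsum T S = 0" by simp
  moreover have "infsum (t (z + v)) S = (\<Sum>\<^sub>\<infinity>w\<in>S. t z (w - v) + T w)"
    by (intro infsum_cong T)
  ultimately have shift: "infsum (t (z + v)) S = infsum (t z) (\<Lambda> - {0, - v})"
    using infsum_add[OF sum2 \<open>T summable_on S\<close>] infsum_reindex_bij_betw[OF bij, of "t z"]
    by simp
  \<comment> \<open>The omitted terms at \<open>v\<close> and \<open>- v\<close> are now restored:
    together with the polar terms outside the sums, each side has 1/z^2 + 1/(z + v)^2 -
    1/v^2.\<close>
  have "infsum (t (z + v)) (\<Lambda> - {0}) = t (z + v) v + infsum (t (z + v)) S"
  proof -
    have "\<Lambda> - {0} = insert v S" using assms False by (auto simp: S_def)
    then show ?thesis using sum1 by (simp add: infsum_insert) (simp add: S_def infsum_insert)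
  qed
  moreover have "infsum (t z) (\<Lambda> - {0}) = t z (- v) + infsum (t z) (\<Lambda> - {0, - v})"
  proof -
    have "\<Lambda> - {0} = insert (- v) (\<Lambda> - {0, - v})" using assms False uminus_in_lattice by auto
    moreover have "t z summable_on (\<Lambda> - {0, - v})"
      by (rule summable_on_subset_banach[OF sum_t]) auto
    ultimately show ?thesis by (metis (no_types, lifting) Diff_iff infsum_insert insertI1 insertI2)
  qed
  ultimately show ?thesis
    using shift unfolding weierstrass_p_def t_def by simp
qed simp

lemma weierstrass_p_near_lattice:
  assumes "w \<in> \<Lambda>"
  shows "weierstrass_p w1 w2 (w + u) = 1 / u^2 + regular_part u"
  using weierstrass_p_periodic[OF assms, of u]
  by (simp add: weierstrass_p_def regular_part_def add.commute)

text \<open>Summing \<open>lattice_term_lipschitz\<close> over the lattice gives the constant; the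
  factor 2 in the gap is the one required there.\<close>

lemma regular_part_lipschitz:
  assumes gap: "\<And>w. w \<in> \<Lambda> \<Longrightarrow> w \<noteq> 0 \<Longrightarrow> 2 * \<delta> \<le> norm w"
  obtains C where "0 \<le> C"
    "\<And>u v. norm u \<le> \<delta> \<Longrightarrow> norm v \<le> \<delta> \<Longrightarrow> norm (regular_part u - regular_part v) \<le> C * norm (u - v)"
proof
  define S where "S = (\<Sum>\<^sub>\<infinity>w\<in>\<Lambda> - {0}. 1 / norm w ^ 3)"
  show "0 \<le> 48 * S" unfolding S_def by (auto intro!: infsum_nonneg)
  fix u v :: complex assume uv: "norm u \<le> \<delta>" "norm v \<le> \<delta>"
  define t where "t u w = 1 / (u - w)^2 - 1 / w^2" for u w :: complex
  have "((\<lambda>w. t u w + - t v w) has_sum (regular_part u + - regular_part v)) (\<Lambda> - {0})"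
    unfolding t_def regular_part_def
    by (intro has_sum_add has_sum_uminusI has_sum_infsum summable_lattice_terms)
  moreover have "((\<lambda>w. 48 * norm (u - v) * (1 / norm w ^ 3)) has_sum (48 * norm (u - v) * S)) (\<Lambda> - {0})"
    unfolding S_def by (intro has_sum_cmult_right has_sum_infsum summable_inverse_cube)
  moreover have "norm (t u w + - t v w) \<le> 48 * norm (u - v) * (1 / norm w ^ 3)" if "w \<in> \<Lambda> - {0}" for w
    using lattice_term_lipschitz[of w u v] gap[of w] that uv by (simp add: t_def)
  ultimately have "norm (regular_part u + - regular_part v) \<le> 48 * norm (u - v) * S"
    by (rule norm_infsum_le)
  then show "norm (regular_part u - regular_part v) \<le> 48 * S * norm (u - v)"
    by (simp add: mult_ac)
qed

end

section \<open>Orbits through a sequence of strips\<close>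

lemma exp_lipschitz_Re_le:
  fixes z z' :: complex
  assumes "Re z \<le> b" "Re z' \<le> b"
  shows "norm (exp z - exp z') \<le> exp b * norm (z - z')"
proof (rule field_differentiable_bound)
  show "convex {z. Re z \<le> b}" by (rule convex_halfspace_Re_le)
  show "(exp has_field_derivative exp w) (at w within {z. Re z \<le> b})" for w :: complex
    by (rule DERIV_subset[OF DERIV_exp]) auto
qed (use assms in auto)

lemma inverse_square_lipschitz:
  fixes u v :: complex
  assumes "0 < a" "1 / a \<le> norm u ^ 2" "1 / a \<le> norm v ^ 2" "norm u \<le> 1" "norm v \<le> 1"
  shows "norm (1 / u^2 - 1 / v^2) \<le> 2 * a^2 * norm (u - v)"
proof -
  have nz: "u \<noteq> 0" "v \<noteq> 0" using assms by auto
  have "1 / u^2 - 1 / v^2 = (v - u) * (u + v) / (u^2 * v^2)"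
    using nz by (simp add: field_simps power2_eq_square)
  then have "norm (1 / u^2 - 1 / v^2) = norm (u - v) * norm (u + v) / (norm u ^ 2 * norm v ^ 2)"
    by (simp add: norm_mult norm_divide norm_power norm_minus_commute)
  also have "\<dots> \<le> norm (u - v) * 2 / (1 / a * (1 / a))"
    using assms norm_triangle_ineq[of u v]
    by (intro frac_le mult_left_mono mult_mono) auto
  also have "\<dots> = 2 * a^2 * norm (u - v)" by (simp add: power2_eq_square)
  finally show ?thesis .
qed

text \<open>The gap \<open>3 * r\<close> leaves a distance of at least \<open>r\<close> between
  discs of radius \<open>r\<close> about different lattice points. The Lipschitz bound on the larger
  disc gives continuity of \<open>regular_part\<close> also at the boundary of the disc of radius
  \<open>r\<close>.\<close>

locale lattice_disc = rank_two_lattice +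
  fixes c :: complex and r C :: real
  assumes r_pos: "0 < r" and r_le_1: "r \<le> 1" and C_nonneg: "0 \<le> C"
    and gap: "w \<in> \<Lambda> \<Longrightarrow> w \<noteq> 0 \<Longrightarrow> 3 * r \<le> norm w"
    and regular_lipschitz: "\<lbrakk>norm u \<le> 3 / 2 * r; norm v \<le> 3 / 2 * r\<rbrakk> \<Longrightarrow>
      norm (regular_part u - regular_part v) \<le> C * norm (u - v)"
    and regular_le_1: "norm u \<le> r \<Longrightarrow> norm (regular_part u) \<le> 1"
begin

abbreviation f :: "complex \<Rightarrow> complex" where
  "f \<equiv> \<lambda>z. weierstrass_p w1 w2 (exp z + c)"

lemma f_eq:
  assumes "w \<in> \<Lambda>"
  shows "f z = 1 / (exp z + c - w)^2 + regular_part (exp z + c - w)"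
  using weierstrass_p_near_lattice[OF assms, of "exp z + c - w"] by simp

lemma continuous_on_regular_part: "continuous_on (cball 0 (3 / 2 * r)) regular_part"
proof (rule lipschitz_on_continuous_on)
  show "C-lipschitz_on (cball 0 (3 / 2 * r)) regular_part"
    using C_nonneg by (intro lipschitz_onI) (auto simp: dist_norm intro!: regular_lipschitz)
qed

text \<open>A solution is a fixed point of
  \<open>u \<mapsto> 1 / csqrt (\<zeta> - regular_part u)\<close>. On the disc the radicand has real
  part at least 1/r^2, so the root is continuous and has norm at least 1/r; the disc is mapped into
  itself and Brouwer's theorem applies.\<close>

lemma regular_value_attained:
  assumes "1 + 1 / r^2 \<le> Re \<zeta>"
  obtains u where "u \<noteq> 0" "norm u \<le> r" "1 / u^2 + regular_part u = \<zeta>"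
proof -
  have Re: "1 / r^2 \<le> Re (\<zeta> - regular_part u)" if "norm u \<le> r" for u
    using regular_le_1[OF that] complex_Re_le_cmod[of "regular_part u"] assms by simp
  have "0 < 1 / r^2" using r_pos by simp
  define T where "T u = 1 / csqrt (\<zeta> - regular_part u)" for u
  obtain u where u: "u \<in> cball 0 r" "T u = u"
  proof (rule brouwer_ball[OF r_pos])
    have "continuous_on (cball 0 r) regular_part"
      by (rule continuous_on_subset[OF continuous_on_regular_part]) (use r_pos in auto)
    moreover have "\<zeta> - regular_part u \<notin> \<real>\<^sub>\<le>\<^sub>0" if "u \<in> cball 0 r" for u
      using less_le_trans[OF \<open>0 < 1 / r^2\<close> Re[of u]] that by (auto simp: complex_nonpos_Reals_iff)
    moreover have "\<zeta> \<noteq> regular_part u" if "u \<in> cball 0 r" for u :: complex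
      using less_le_trans[OF \<open>0 < 1 / r^2\<close> Re[of u]] that by auto
    ultimately show "continuous_on (cball 0 r) T"
      unfolding T_def
      by (intro continuous_intros continuous_on_compose2[OF continuous_on_csqrt]) auto
    show "T \<in> cball 0 r \<rightarrow> cball 0 r"
    proof
      fix u :: complex assume "u \<in> cball 0 r"
      then have "1 / r^2 \<le> norm (\<zeta> - regular_part u)"
        using Re[of u] complex_Re_le_cmod[of "\<zeta> - regular_part u"] by simp
      then have "sqrt (1 / r^2) \<le> norm (csqrt (\<zeta> - regular_part u))"
        by (simp add: norm_csqrt del: real_sqrt_divide)
      then have "1 / r \<le> norm (csqrt (\<zeta> - regular_part u))"
        using r_pos by (simp add: real_sqrt_divide)
      then have "norm (T u) \<le> r"
        using r_pos frac_le[of 1 1 "1 / r" "norm (csqrt (\<zeta> - regular_part u))"] by (simp add: T_def norm_divide)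
      then show "T u \<in> cball 0 r" by simp
    qed
  qed (rule that)
  have norm_u: "norm u \<le> r" using u(1) by simp
  have nz: "\<zeta> - regular_part u \<noteq> 0"
    using Re[OF norm_u] \<open>0 < 1 / r^2\<close> by auto
  have "1 / u^2 = csqrt (\<zeta> - regular_part u)^2"
    using arg_cong[OF u(2), of "\<lambda>u. 1 / u^2"] by (simp add: T_def power_divide)
  then have "1 / u^2 + regular_part u = \<zeta>" by simp
  moreover have "u \<noteq> 0" using u(2) nz by (auto simp: T_def)
  ultimately show ?thesis using norm_u by (intro that)
qed

lemma isCont_f:
  assumes "w \<in> \<Lambda>" "exp z + c \<noteq> w" "norm (exp z + c - w) \<le> r"
  shows "isCont f z"
proof -
  have "exp z + c - w \<in> interior (cball 0 (3 / 2 * r))" using assms(3) r_pos by simp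
  then have "isCont regular_part (exp z + c - w)"
    by (rule continuous_on_interior[OF continuous_on_regular_part])
  then have "isCont (\<lambda>z. regular_part (exp z + c - w)) z"
    by (rule isCont_o2[where f = "\<lambda>z. exp z + c - w" and g = regular_part, rotated])
       (intro continuous_intros)
  moreover have "isCont (\<lambda>z. 1 / (exp z + c - w)^2) z"
    using assms(2) by (auto intro!: continuous_intros)
  ultimately have "isCont (\<lambda>z. 1 / (exp z + c - w)^2 + regular_part (exp z + c - w)) z"
    by (rule continuous_add[rotated])
  moreover have "f = (\<lambda>z. 1 / (exp z + c - w)^2 + regular_part (exp z + c - w))"
    by (rule ext) (rule f_eq[OF assms(1)])
  ultimately show ?thesis by simp
qed

section \<open>Strips, pieces and the lattice points indexing them\<close>

definition strip :: "real \<Rightarrow> complex set" where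
  "strip x = {z. x \<le> Re z \<and> Re z \<le> x + 1 \<and> \<bar>Im z\<bar> \<le> pi}"

text \<open>The lower bound keeps the piece away from the pole, which makes \<open>f\<close>
  Lipschitz there. The 7 leaves room for all values in the next strip: for nonnegative
  \<open>x\<close> these have norm at most x + 6, and \<open>regular_part\<close> adds at most
  1.\<close>

definition piece :: "real \<Rightarrow> complex \<Rightarrow> complex set" where
  "piece x w = {z \<in> strip x. 1 / (x + 7) \<le> norm (exp z + c - w) ^ 2 \<and> norm (exp z + c - w) \<le> r}"

definition period_sum :: real where
  "period_sum = norm w1 + norm w2"

text \<open>The divisor keeps the total displacement \<open>grid_size x * period_sum\<close> within
  \<open>exp x / 4\<close>.\<close>

definition grid_size :: "real \<Rightarrow> nat" where
  "grid_size x = nat \<lfloor>exp x / (4 * period_sum)\<rfloor>"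

text \<open>
  Lattice points near \<open>7/4 \<cdot> exp x\<close> times the unit vector along \<open>w2\<close>: they lie well inside the
  annulus \<open>exp x \<le> |v| \<le> exp (x + 1)\<close>, which is the image of the strip under \<open>exp\<close>.
\<close>

definition grid :: "real \<Rightarrow> complex set" where
  "grid x = (\<lambda>(a, b). of_int (int a) * w1 + of_int (\<lfloor>7 / 4 * exp x / norm w2\<rfloor> + int b) * w2) `
     ({..<grid_size x} \<times> {..<grid_size x})"

text \<open>Lipschitz constant of \<open>f\<close> on a piece: the first factor comes from
  \<open>exp\<close>, the summands of the second from 1/u^2 and from
  \<open>regular_part\<close>.\<close>

definition expansion :: "real \<Rightarrow> real" where
  "expansion x = exp (x + 1) * (2 * (x + 7)^2 + C)"

lemma period_sum_pos: "0 < period_sum"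
  using w2_nonzero by (simp add: period_sum_def add_nonneg_pos)

lemma finite_grid: "finite (grid x)"
  by (simp add: grid_def)

lemma grid_subset_lattice: "grid x \<subseteq> \<Lambda>"
  unfolding grid_def period_lattice_def by (clarify, intro CollectI exI conjI) (rule refl, simp)

lemma card_grid: "card (grid x) = grid_size x ^ 2"
proof -
  have "inj_on (\<lambda>(a, b). of_int (int a) * w1 + of_int (\<lfloor>7 / 4 * exp x / norm w2\<rfloor> + int b) * w2)
      ({..<grid_size x} \<times> {..<grid_size x})"
  proof (rule inj_onI, clarify)
    fix a b a' b' :: nat
    assume "of_int (int a) * w1 + of_int (\<lfloor>7 / 4 * exp x / norm w2\<rfloor> + int b) * w2 =
      of_int (int a') * w1 + of_int (\<lfloor>7 / 4 * exp x / norm w2\<rfloor> + int b') * w2"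
    then show "a = a' \<and> b = b'"
      using injD[OF inj_coefficients, of
        "(int a, \<lfloor>7 / 4 * exp x / norm w2\<rfloor> + int b)" "(int a', \<lfloor>7 / 4 * exp x / norm w2\<rfloor> + int b')"]
      by simp
  qed
  then show ?thesis by (simp add: grid_def card_image card_cartesian_product power2_eq_square)
qed

lemma grid_size_le: "grid_size x * period_sum \<le> exp x / 4"
proof -
  have "grid_size x \<le> exp x / (4 * period_sum)"
    using period_sum_pos by (simp add: grid_size_def)
  then show ?thesis using period_sum_pos by (simp add: field_simps)
qed

text \<open>The floor loses less than 1, and the hypothesis makes 1 at most half of the
  quotient.\<close>

lemma grid_size_ge:
  assumes "8 * period_sum \<le> exp x"
  shows "exp x / (8 * period_sum) \<le> grid_size x"
proof -
  have "exp x / (4 * period_sum) < grid_size x + 1"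
    unfolding grid_size_def by linarith
  moreover have "1 \<le> exp x / (8 * period_sum)"
    using assms period_sum_pos by simp
  moreover have "exp x / (4 * period_sum) = 2 * (exp x / (8 * period_sum))" by simp
  ultimately show ?thesis by linarith
qed

lemma grid_norm:
  assumes "w \<in> grid x"
  shows "\<bar>norm w - 7 / 4 * exp x\<bar> \<le> exp x / 4"
proof -
  define t where "t = 7 / 4 * exp x / norm w2"
  obtain a b where ab: "a < grid_size x" "b < grid_size x"
    and w: "w = of_int (int a) * w1 + of_int (\<lfloor>t\<rfloor> + int b) * w2"
    using assms by (auto simp: grid_def t_def)
  have "norm (of_real t * w2) = 7 / 4 * exp x"
    unfolding norm_mult norm_of_real using w2_nonzero by (simp add: t_def)
  then have "\<bar>norm w - 7 / 4 * exp x\<bar> \<le> norm (w - of_real t * w2)"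
    using norm_triangle_ineq3[of w "of_real t * w2"] by simp
  also have "w - of_real t * w2 = of_real a * w1 + of_real (real_of_int \<lfloor>t\<rfloor> + real b - t) * w2"
    by (simp add: w algebra_simps)
  also have "norm \<dots> \<le> a * norm w1 + \<bar>real_of_int \<lfloor>t\<rfloor> + real b - t\<bar> * norm w2"
    using norm_triangle_ineq[of "of_real a * w1" "of_real (real_of_int \<lfloor>t\<rfloor> + real b - t) * w2"]
    unfolding norm_mult norm_of_real by simp
  also have "\<dots> \<le> grid_size x * norm w1 + grid_size x * norm w2"
  proof (intro add_mono mult_right_mono)
    \<comment> \<open>Rounding down loses less than 1, so the coefficient is greater than -1 and at
      most \<open>grid_size x - 1\<close>, where \<open>grid_size x\<close> is at least 1.\<close>
    have "real b + 1 \<le> grid_size x" using ab by linarith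
    moreover have "of_int \<lfloor>t\<rfloor> \<le> t" "t < of_int \<lfloor>t\<rfloor> + 1" by linarith+
    ultimately show "\<bar>real_of_int \<lfloor>t\<rfloor> + real b - t\<bar> \<le> grid_size x" by linarith
  qed (use ab in auto)
  also have "\<dots> \<le> exp x / 4"
    using grid_size_le[of x] by (simp add: period_sum_def distrib_left)
  finally show ?thesis .
qed

lemma compact_piece: "compact (piece x w)"
proof -
  have "piece x w \<subseteq> cball 0 (\<bar>x\<bar> + 1 + pi)"
  proof
    fix z assume "z \<in> piece x w"
    then show "z \<in> cball 0 (\<bar>x\<bar> + 1 + pi)"
      using cmod_le[of z] by (auto simp: piece_def strip_def)
  qed
  then have "bounded (piece x w)" by (rule bounded_subset[OF bounded_cball])
  moreover have "closed (piece x w)"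
    unfolding piece_def strip_def mem_Collect_eq
    by (intro closed_Collect_conj closed_Collect_le continuous_intros)
  ultimately show ?thesis by (simp add: compact_eq_bounded_closed)
qed

lemma f_lipschitz_piece:
  assumes "0 \<le> x" "w \<in> \<Lambda>" "z \<in> piece x w" "z' \<in> piece x w"
  shows "dist (f z) (f z') \<le> expansion x * dist z z'"
proof -
  define u v where "u = exp z + c - w" and "v = exp z' + c - w"
  have uv: "1 / (x + 7) \<le> norm u ^ 2" "norm u \<le> r" "1 / (x + 7) \<le> norm v ^ 2" "norm v \<le> r"
    using assms by (auto simp: piece_def u_def v_def)
  have "dist (f z) (f z') = norm ((1 / u^2 - 1 / v^2) + (regular_part u - regular_part v))"
    unfolding f_eq[OF assms(2)] u_def[symmetric] v_def[symmetric] by (simp add: dist_norm algebra_simps)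
  also have "\<dots> \<le> norm (1 / u^2 - 1 / v^2) + norm (regular_part u - regular_part v)"
    by (rule norm_triangle_ineq)
  also have "\<dots> \<le> 2 * (x + 7)^2 * norm (u - v) + C * norm (u - v)"
    using uv r_pos r_le_1 assms(1) by (intro add_mono inverse_square_lipschitz regular_lipschitz) auto
  also have "\<dots> = (2 * (x + 7)^2 + C) * norm (exp z - exp z')"
    by (simp add: u_def v_def algebra_simps)
  also have "\<dots> \<le> (2 * (x + 7)^2 + C) * (exp (x + 1) * norm (z - z'))"
    using assms C_nonneg by (intro mult_left_mono exp_lipschitz_Re_le) (auto simp: piece_def strip_def)
  finally show ?thesis by (simp add: expansion_def dist_norm mult_ac)
qed

text \<open>The centres are \<open>3 * r\<close> apart and each local coordinate has norm at most
  \<open>r\<close>, so \<open>exp z\<close> and \<open>exp z'\<close> are at least \<open>r\<close>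
  apart; the Lipschitz constant of \<open>exp\<close> on the strip carries this back.\<close>

lemma pieces_separated:
  assumes "w \<in> \<Lambda>" "w' \<in> \<Lambda>" "w \<noteq> w'" "z \<in> piece x w" "z' \<in> piece x w'"
  shows "r * exp (- (x + 1)) \<le> dist z z'"
proof -
  have "3 * r \<le> norm (w - w')" using assms by (intro gap diff_in_lattice) auto
  also have "w - w' = (exp z - exp z') - ((exp z + c - w) - (exp z' + c - w'))" by simp
  also have "norm \<dots> \<le> norm (exp z - exp z') + (norm (exp z + c - w) + norm (exp z' + c - w'))"
    by (intro order_trans[OF norm_triangle_ineq4] add_left_mono norm_triangle_ineq4)
  also have "\<dots> \<le> exp (x + 1) * norm (z - z') + (r + r)"
    using assms by (intro add_mono exp_lipschitz_Re_le) (auto simp: piece_def strip_def)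
  finally have "r \<le> exp (x + 1) * dist z z'" by (simp add: dist_norm)
  then have "r * exp (- (x + 1)) \<le> exp (x + 1) * dist z z' * exp (- (x + 1))"
    by (intro mult_right_mono) auto
  also have "\<dots> = (exp (x + 1) * exp (- (x + 1))) * dist z z'" by (simp only: mult_ac)
  also have "\<dots> = dist z z'" by (simp only: exp_minus_inverse mult_1_left)
  finally show ?thesis .
qed

text \<open>The local equation is solved for \<open>u\<close> first, then
  \<open>exp z = w - c + u\<close> by the logarithm. The modulus of \<open>w\<close> lies between
  3/2 and 2 times \<open>exp x\<close>, and the shift by \<open>u - c\<close> is at most
  \<open>exp x / 2\<close>, so the right side stays in the annulus covered by the strip.\<close>

lemma strip_subset_image_piece:
  assumes x: "0 \<le> x" "1 / r^2 \<le> x" "2 * (norm c + 1) \<le> exp x" and "w \<in> grid x"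
  shows "strip (x + 1) \<subseteq> f ` piece x w"
proof
  fix \<zeta> assume \<zeta>: "\<zeta> \<in> strip (x + 1)"
  obtain u where u: "u \<noteq> 0" "norm u \<le> r" "1 / u^2 + regular_part u = \<zeta>"
    by (rule regular_value_attained[of \<zeta>]) (use \<zeta> x in \<open>auto simp: strip_def\<close>)
  define v where "v = w - c + u"
  have "\<bar>norm v - norm w\<bar> \<le> norm (u - c)"
    using norm_triangle_ineq3[of v w] by (simp add: v_def)
  also have "\<dots> \<le> norm c + 1"
    using norm_triangle_ineq4[of u c] u(2) r_le_1 by simp
  finally have vw: "\<bar>norm v - norm w\<bar> \<le> norm c + 1" .
  have "exp x \<le> norm v"
    using vw grid_norm[OF assms(4)] x(3) by argo
  moreover have "norm v \<le> exp x * (5 / 2)"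
    using vw grid_norm[OF assms(4)] x(3) by argo
  \<comment> \<open>The quadratic Taylor bound gives e at least 1 + 1 + 1/2.\<close>
  moreover have "exp x * (5 / 2) \<le> exp (x + 1)"
    using exp_lower_Taylor_quadratic[of "1 :: real"] by (simp add: exp_add)
  ultimately have v: "exp x \<le> norm v" "norm v \<le> exp (x + 1)" by auto
  then have "v \<noteq> 0" using exp_gt_zero[of x] by auto
  define z where "z = Ln v"
  have exp_z: "exp z = v" using \<open>v \<noteq> 0\<close> by (simp add: z_def)
  have "x \<le> Re z" "Re z \<le> x + 1"
    using v \<open>v \<noteq> 0\<close> by (simp_all add: z_def ln_ge_iff ln_le_cancel_iff[of _ "exp (x + 1)", simplified])
  moreover have "\<bar>Im z\<bar> \<le> pi"
    using mpi_less_Im_Ln[OF \<open>v \<noteq> 0\<close>] Im_Ln_le_pi[OF \<open>v \<noteq> 0\<close>] by (simp add: z_def)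
  ultimately have "z \<in> strip x" by (simp add: strip_def)
  have "1 / (x + 7) \<le> norm u ^ 2"
  proof -
    have "1 / norm u ^ 2 = norm (\<zeta> - regular_part u)"
      using u(3) by (simp add: norm_divide norm_power flip: u(3))
    also have "\<dots> \<le> norm \<zeta> + 1"
      using norm_triangle_ineq4[of \<zeta> "regular_part u"] regular_le_1[OF u(2)] by simp
    \<comment> \<open>The real part is at most x + 2 and the imaginary part is below 4 in absolute
      value.\<close>
    also have "norm \<zeta> \<le> x + 6"
      using \<zeta> x cmod_le[of \<zeta>] pi_less_4 by (auto simp: strip_def)
    finally show ?thesis using u(1) x by (simp add: field_simps)
  qed
  moreover have "exp z + c - w = u" by (simp add: exp_z v_def)
  ultimately have "z \<in> piece x w" using \<open>z \<in> strip x\<close> u(2) by (simp add: piece_def)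
  moreover have "f z = \<zeta>"
    using f_eq[of w z] assms(4) grid_subset_lattice u(3) \<open>exp z + c - w = u\<close> by auto
  ultimately show "\<zeta> \<in> f ` piece x w" by blast
qed

section \<open>Positive measure of the escaping set\<close>

lemma not_pole_piece:
  assumes "0 \<le> x" "w \<in> \<Lambda>" "z \<in> piece x w"
  shows "\<not> is_pole f z"
proof
  assume "is_pole f z"
  have "0 < 1 / (x + 7)" using assms(1) by simp
  then have "exp z + c \<noteq> w" using assms(3) by (auto simp: piece_def)
  then have "isCont f z" using assms by (intro isCont_f) (auto simp: piece_def)
  then show False
    using \<open>is_pole f z\<close> not_tendsto_and_filterlim_at_infinity[of "at z" f "f z"]
    by (auto simp: is_pole_def isCont_def)
qed

text \<open>The left side grows like a power of x times exp (s x), the right side like exp (2 x).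
  The right side will bound the number of branches from below; the factor \<open>exp s\<close> pays
  for the gap, which shrinks by a factor e at each step.\<close>

lemma expansion_eventually_small:
  assumes "0 < s" "s < 2"
  shows "\<forall>\<^sub>F x in at_top. exp s * expansion x powr s \<le> (exp x / (8 * period_sum))^2"
proof -
  have "((\<lambda>x. exp s * expansion x powr s / (exp x / (8 * period_sum))^2) \<longlongrightarrow> 0) at_top"
    unfolding expansion_def using assms period_sum_pos by real_asymp
  then have "\<forall>\<^sub>F x in at_top. exp s * expansion x powr s / (exp x / (8 * period_sum))^2 < 1"
    by (rule order_tendstoD) simp
  then show ?thesis
    using period_sum_pos by (auto elim!: eventually_mono simp: divide_less_eq_1)
qed

theorem hausdorff_measure_escaping_set_nonzero:
  assumes "0 < s" "s < 2"
  shows "hausdorff_measure s (escaping_set f) \<noteq> 0"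
proof -
  have "\<forall>\<^sub>F x in at_top. exp s * expansion x powr s \<le> (exp x / (8 * period_sum))^2 \<and>
      8 * period_sum \<le> exp x \<and> 2 * (norm c + 1) \<le> exp x \<and> 1 / r^2 \<le> x \<and> 0 \<le> x"
    using expansion_eventually_small[OF assms] exp_at_top
    by (intro eventually_conj eventually_ge_at_top) (auto simp: filterlim_at_top)
  then obtain X where X: "\<And>x. X \<le> x \<Longrightarrow> exp s * expansion x powr s \<le> (exp x / (8 * period_sum))^2"
      "\<And>x. X \<le> x \<Longrightarrow> 8 * period_sum \<le> exp x" "\<And>x. X \<le> x \<Longrightarrow> 2 * (norm c + 1) \<le> exp x"
      "\<And>x. X \<le> x \<Longrightarrow> 1 / r^2 \<le> x" "\<And>x. X \<le> x \<Longrightarrow> 0 \<le> x"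
    unfolding eventually_at_top_linorder by blast
  define x where "x n = X + real n" for n
  have X_le: "X \<le> x n" for n by (simp add: x_def)
  have x_Suc: "x (Suc n) = x n + 1" for n by (simp add: x_def)
  have expansion_ge_1: "1 \<le> expansion (x n)" for n
  proof -
    have "1 \<le> exp (x n + 1)" using X(5)[OF X_le[of n]] by simp
    moreover have "1 \<le> 2 * (x n + 7)^2 + C"
      using X(5)[OF X_le[of n]] one_le_power[of "x n + 7" 2] C_nonneg by linarith
    ultimately show ?thesis unfolding expansion_def by (metis mult_mono' mult_1 zero_le_one)
  qed
  have grid_size_pos: "0 < grid_size (x n)" for n
    using grid_size_ge[OF X(2)[OF X_le[of n]]] period_sum_pos
    by (metis divide_pos_pos exp_gt_zero less_le_trans mult_pos_pos of_nat_0_less_iff zero_less_numeral)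
  have onto: "w \<in> grid (x n) \<Longrightarrow> strip (x (Suc n)) \<subseteq> f ` piece (x n) w" for n w
    unfolding x_Suc by (intro strip_subset_image_piece X X_le)
  interpret expanding_itineraries f "\<lambda>n. grid (x n)" "\<lambda>n. piece (x n)"
    "\<lambda>n. expansion (x n)" "\<lambda>n. r * exp (- (x n + 1))"
  proof
    fix n
    show "finite (grid (x n))" by (rule finite_grid)
    show "grid (x n) \<noteq> {}" using card_grid[of "x n"] grid_size_pos[of n] by auto
    show "0 < expansion (x n)" using expansion_ge_1[of n] by simp
    show "0 < r * exp (- (x n + 1))" using r_pos by simp
    fix w assume w: "w \<in> grid (x n)"
    then have "w \<in> \<Lambda>" using grid_subset_lattice by blast
    show "compact (piece (x n) w)" by (rule compact_piece)
    \<comment> \<open>A piece is nonempty because its image covers a strip, which contains a real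
      point.\<close>
    have "of_real (x (Suc n)) \<in> strip (x (Suc n))" by (simp add: strip_def)
    then show "piece (x n) w \<noteq> {}" using onto[OF w] by blast
    show "dist (f y) (f y') \<le> expansion (x n) * dist y y'" if "y \<in> piece (x n) w" "y' \<in> piece (x n) w" for y y'
      using that \<open>w \<in> \<Lambda>\<close> by (intro f_lipschitz_piece X(5) X_le)
    fix w'
    show "r * exp (- (x n + 1)) \<le> dist y y'"
      if "w' \<in> grid (x n)" "w \<noteq> w'" "y \<in> piece (x n) w" "y' \<in> piece (x n) w'" for y y'
      using that \<open>w \<in> \<Lambda>\<close> grid_subset_lattice by (intro pieces_separated[of w w']) auto
    show "piece (x (Suc n)) w' \<subseteq> f ` piece (x n) w"
      using onto[OF w] by (auto simp: piece_def)
  qed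
  \<comment> \<open>This is the gap at time 0 to the power \<open>- s\<close>; it makes the final
    lower bound in the mass estimate exactly 1.\<close>
  define K where "K = exp (s * (X + 1)) / r powr s"
  have "hausdorff_measure s limit_set \<noteq> 0"
  proof (rule hausdorff_measure_limit_set_nonzero)
    show "0 < K" using r_pos by (simp add: K_def)
    show "1 \<le> K * (\<Prod>j<n. real (card (grid (x j)))) * scale n powr s" for n
    proof -
      define E where "E = (\<Prod>j<n. expansion (x j))"
      have "0 < E" unfolding E_def by (intro prod_pos) (simp add: L_pos)
      have "exp s * expansion (x j) powr s \<le> real (card (grid (x j)))" for j
      proof -
        have "(exp (x j) / (8 * period_sum))^2 \<le> (real (grid_size (x j)))^2"
          using grid_size_ge[OF X(2)[OF X_le]] period_sum_pos by (intro power_mono) auto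
        then show ?thesis using X(1)[OF X_le[of j]] by (simp add: card_grid)
      qed
      then have "(\<Prod>j<n. exp s * expansion (x j) powr s) \<le> (\<Prod>j<n. real (card (grid (x j))))"
        by (intro prod_mono) auto
      also have "(\<Prod>j<n. exp s * expansion (x j) powr s) = exp (s * n) * E powr s"
        using L_pos by (simp add: E_def prod.distrib prod_powr_distrib less_imp_le exp_of_nat2_mult)
      finally have card: "exp (s * n) * E powr s \<le> (\<Prod>j<n. real (card (grid (x j))))" .
      have "scale n powr s = (r powr s * exp (- (x n + 1)) powr s) / E powr s"
        unfolding scale_def E_def[symmetric] by (simp only: powr_divide powr_mult)
      also have "exp (- (x n + 1)) powr s = exp (- (s * (X + 1) + s * n))"
        by (simp add: powr_def x_def algebra_simps)
      also have "\<dots> = 1 / (exp (s * (X + 1)) * exp (s * n))"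
        by (simp only: exp_minus exp_add inverse_eq_divide)
      finally have "K * (exp (s * n) * E powr s) * scale n powr s = 1"
        using r_pos \<open>0 < E\<close> by (simp add: K_def)
      then show ?thesis
        using mult_right_mono[OF mult_left_mono[OF card, of K], of "scale n powr s"] \<open>0 < K\<close> by simp
    qed
    show "\<exists>n. scale n < d" if "0 < d" for d
    proof -
      obtain n where n: "exp (- real n) < d"
      proof -
        have "((\<lambda>n. exp (- real n)) \<longlongrightarrow> 0) sequentially" by real_asymp
        then show ?thesis
          using that \<open>0 < d\<close> by (metis (no_types, lifting) eventually_sequentially order_refl order_tendstoD(2))
      qed
      \<comment> \<open>The product of the expansions is at least 1, so the decay of the gap alone
        suffices.\<close>
      have "scale n \<le> r * exp (- (x n + 1)) / 1"
        unfolding scale_def using r_pos expansion_ge_1 by (intro divide_left_mono prod_ge_1) (auto intro!: prod_pos L_pos)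
      also have "\<dots> \<le> 1 * exp (- real n)"
        using r_le_1 r_pos X(5)[of X] by (simp only: div_by_1, intro mult_mono) (auto simp: x_def)
      also have "\<dots> < d" using n by simp
      finally show ?thesis by (rule exI)
    qed
  qed fact
  moreover have "limit_set \<subseteq> escaping_set f"
  proof
    fix z assume "z \<in> limit_set"
    then have "\<exists>w\<in>grid (x n). (f ^^ n) z \<in> piece (x n) w" for n
      by (auto simp: limit_set_def level_def)
    then obtain w where w: "\<And>n. w n \<in> grid (x n)" "\<And>n. (f ^^ n) z \<in> piece (x n) (w n)"
      by metis
    have "\<not> is_pole f ((f ^^ n) z)" for n
      using w[of n] grid_subset_lattice X(5)[OF X_le[of n]] by (intro not_pole_piece[of "x n" "w n"]) auto
    \<comment> \<open>The n-th iterate has real part at least \<open>X + n\<close>, and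
      \<open>X\<close> is nonnegative.\<close>
    moreover have "real n \<le> norm ((f ^^ n) z)" for n
      using w(2)[of n] complex_Re_le_cmod[of "(f ^^ n) z"] X(5)[of X]
      by (auto simp: piece_def strip_def x_def)
    then have "filterlim (\<lambda>n. norm ((f ^^ n) z)) at_top sequentially"
      by (intro filterlim_at_top_mono[OF filterlim_real_sequentially] always_eventually allI)
    then have "filterlim (\<lambda>n. (f ^^ n) z) at_infinity sequentially"
      by (simp add: filterlim_at_infinity_conv_norm_at_top)
    ultimately show "z \<in> escaping_set f" by (simp add: escaping_set_def)
  qed
  ultimately show ?thesis
    using hausdorff_measure_mono_set[of limit_set "escaping_set f" s] by auto
qed

end

text \<open>With \<delta> the lattice gap, r at most \<delta>/3 keeps the larger disc within radius
  \<delta>/2, where the Lipschitz bound holds. As \<open>regular_part\<close> vanishes at 0, r at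
  most 1/(C + 1) bounds it by C/(C + 1) on the smaller disc.\<close>

lemma (in rank_two_lattice) lattice_disc_exists:
  obtains r C where "lattice_disc w1 w2 r C"
proof -
  obtain \<delta> where \<delta>: "0 < \<delta>" "\<And>w. w \<in> \<Lambda> \<Longrightarrow> w \<noteq> 0 \<Longrightarrow> \<delta> \<le> norm w"
    using lattice_gap by blast
  obtain C where C: "0 \<le> C" "\<And>u v. norm u \<le> \<delta> / 2 \<Longrightarrow> norm v \<le> \<delta> / 2 \<Longrightarrow>
      norm (regular_part u - regular_part v) \<le> C * norm (u - v)"
    by (rule regular_part_lipschitz[of "\<delta> / 2"]) (use \<delta> in auto)
  define r where "r = min (min (\<delta> / 3) 1) (1 / (C + 1))"
  have r: "0 < r" "r \<le> \<delta> / 3" "r \<le> 1" "r \<le> 1 / (C + 1)"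
    using \<delta>(1) C(1) by (auto simp: r_def min_le_iff_disj)
  have "lattice_disc w1 w2 r C"
  proof
    show "3 * r \<le> norm w" if "w \<in> \<Lambda>" "w \<noteq> 0" for w
      using \<delta>(2)[OF that] r(2) by simp
    show "norm (regular_part u - regular_part v) \<le> C * norm (u - v)"
      if "norm u \<le> 3 / 2 * r" "norm v \<le> 3 / 2 * r" for u v
      using that r(2) by (intro C(2)) auto
    show "norm (regular_part u) \<le> 1" if "norm u \<le> r" for u
    proof -
      have "norm (regular_part u) \<le> C * norm u"
        using C(2)[of u 0] that r \<delta>(1) by (simp add: regular_part_0)
      also have "\<dots> \<le> C * (1 / (C + 1))" using that r(4) C(1) by (intro mult_left_mono) auto
      also have "\<dots> \<le> 1" using C(1) by (simp add: field_simps)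
      finally show ?thesis .
    qed
  qed (use r C in auto)
  then show ?thesis by (rule that)
qed

theorem proposition1p1:
  fixes w1 w2 c :: complex
  assumes "w2 \<noteq> 0"
    and "\<nexists>r::real. w1 = of_real r * w2"
    and "\<not> is_pole (weierstrass_p w1 w2) c"
  shows "hausdorff_dim (escaping_set (\<lambda>z. weierstrass_p w1 w2 (exp z + c))) = 2"
proof -
  interpret rank_two_lattice w1 w2 using assms by unfold_locales
  obtain r C where "lattice_disc w1 w2 r C" using lattice_disc_exists .
  then interpret lattice_disc w1 w2 c r C .
  show ?thesis
    by (rule hausdorff_dim_complex_eq_2) (rule hausdorff_measure_escaping_set_nonzero)
qed

end
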